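(* Let $1\le p<q$ be fixed integers. Given a horocyclic word $w\in\{t,T,a,A\}^*$, the length-lexicographical normal form $\mathrm{llnf}(w)$ in $\mathbf{BS}(p,q)$ can be computed in linear time (where the cost of arithmetic operations is considered to be constant).
   Context: $\mathbf{BS}(p,q)=\langle a,t\mid ta^pt^{-1}=a^q\rangle$. Words over $\{t,T,a,A\}$ are read in $\mathbf{BS}(p,q)$ with $T=t^{-1}$, $A=a^{-1}$; $u\sim v$ means equality in the group. A word is horocyclic if it represents an element of the subgroup $\langle a\rangle$. Order words over $\{t,T,a,A\}$ by length first and then lexicographically with $t<T<a<A$; $\mathrm{llnf}(w)$ is the smallest word $v$ with $v\sim w$. Integers occurring in the computation are kept in binary; $p,q$ are constants. *)

theory Defs
  imports "HOL-Algebra.Generated_Groups"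
begin

section \<open>The Baumslag-Solitar group as a group of words\<close>

text \<open>The letters stand for \<open>t\<close>, \<open>T\<close>, \<open>a\<close>, \<open>A\<close>, where \<open>T\<close> and \<open>A\<close> are the formal inverses of
  \<open>t\<close> and \<open>a\<close>.\<close>

datatype letter = Pos_t | Neg_t | Pos_a | Neg_a

fun inv_letter :: "letter \<Rightarrow> letter" where
  "inv_letter Pos_t = Neg_t"
| "inv_letter Neg_t = Pos_t"
| "inv_letter Pos_a = Neg_a"
| "inv_letter Neg_a = Pos_a"

type_synonym word = "letter list"

text \<open>Equality in \<open>\<langle>a, t | t a\<^sup>p t\<^sup>-\<^sup>1 = a\<^sup>q\<rangle>\<close>: the least congruence on words containing the
  inverse laws and the defining relation.\<close>

inductive bs_eq :: "nat \<Rightarrow> nat \<Rightarrow> word \<Rightarrow> word \<Rightarrow> bool" for p q :: nat where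
  refl: "bs_eq p q u u"
| sym: "bs_eq p q u v \<Longrightarrow> bs_eq p q v u"
| trans: "bs_eq p q u v \<Longrightarrow> bs_eq p q v w \<Longrightarrow> bs_eq p q u w"
| append: "bs_eq p q u u' \<Longrightarrow> bs_eq p q v v' \<Longrightarrow> bs_eq p q (u @ v) (u' @ v')"
| cancel: "bs_eq p q [x, inv_letter x] []"
| relator: "bs_eq p q ([Pos_t] @ replicate p Pos_a @ [Neg_t]) (replicate q Pos_a)"

definition bs_elem :: "nat \<Rightarrow> nat \<Rightarrow> word \<Rightarrow> word set" where
  "bs_elem p q w = {v. bs_eq p q w v}"

definition BS :: "nat \<Rightarrow> nat \<Rightarrow> word set monoid" where
  "BS p q = \<lparr>carrier = range (bs_elem p q),
             mult = (\<lambda>X Y. \<Union>u\<in>X. \<Union>v\<in>Y. bs_elem p q (u @ v)),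
             one = bs_elem p q []\<rparr>"

lemma bs_elem_eq_iff: "bs_elem p q u = bs_elem p q v \<longleftrightarrow> bs_eq p q u v"
proof
  assume "bs_elem p q u = bs_elem p q v"
  moreover have "v \<in> bs_elem p q v" by (simp add: bs_elem_def bs_eq.refl)
  ultimately have "v \<in> bs_elem p q u" by simp
  then show "bs_eq p q u v" by (simp add: bs_elem_def)
next
  assume "bs_eq p q u v"
  then have "bs_eq p q u w \<longleftrightarrow> bs_eq p q v w" for w
    using bs_eq.sym bs_eq.trans by metis
  then show "bs_elem p q u = bs_elem p q v" by (simp add: bs_elem_def)
qed

lemma mult_bs_elem [simp]:
  "bs_elem p q u \<otimes>\<^bsub>BS p q\<^esub> bs_elem p q v = bs_elem p q (u @ v)"
proof -
  have eq: "bs_elem p q (u' @ v') = bs_elem p q (u @ v)"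
    if "u' \<in> bs_elem p q u" "v' \<in> bs_elem p q v" for u' v'
    unfolding bs_elem_eq_iff
    by (rule bs_eq.sym[OF bs_eq.append]) (use that in \<open>simp_all add: bs_elem_def\<close>)
  have mem: "u \<in> bs_elem p q u" "v \<in> bs_elem p q v"
    by (simp_all add: bs_elem_def bs_eq.refl)
  have "(\<Union>u'\<in>bs_elem p q u. \<Union>v'\<in>bs_elem p q v. bs_elem p q (u' @ v')) =
      (\<Union>u'\<in>bs_elem p q u. \<Union>v'\<in>bs_elem p q v. bs_elem p q (u @ v))"
    by (intro SUP_cong[OF HOL.refl] eq)
  also have "\<dots> = bs_elem p q (u @ v)"
    using mem by blast
  finally show ?thesis
    by (simp add: BS_def)
qed

lemma one_BS [simp]: "\<one>\<^bsub>BS p q\<^esub> = bs_elem p q []"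
  by (simp add: BS_def)

lemma carrier_BS [simp]: "carrier (BS p q) = range (bs_elem p q)"
  by (simp add: BS_def)

lemma inv_letter_inv_letter [simp]: "inv_letter (inv_letter x) = x"
  by (cases x) auto

lemma bs_eq_inv_word: "bs_eq p q (map inv_letter (rev w) @ w) []"
proof (induction w)
  case Nil
  show ?case by (simp add: bs_eq.refl)
next
  case (Cons x w)
  have "bs_eq p q [inv_letter x, x] []"
    using bs_eq.cancel[where x = "inv_letter x"] by simp
  then have "bs_eq p q ([inv_letter x, x] @ w) ([] @ w)"
    by (rule bs_eq.append[OF _ bs_eq.refl])
  then have "bs_eq p q (map inv_letter (rev w) @ ([inv_letter x, x] @ w))
      (map inv_letter (rev w) @ ([] @ w))"
    by (rule bs_eq.append[OF bs_eq.refl])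
  from bs_eq.trans[OF this] Cons.IH show ?case
    by simp
qed

lemma group_BS: "group (BS p q)"
proof (rule groupI)
  fix X assume "X \<in> carrier (BS p q)"
  then obtain w where "X = bs_elem p q w" by auto
  moreover have "bs_elem p q (map inv_letter (rev w) @ w) = bs_elem p q []"
    using bs_eq_inv_word by (simp add: bs_elem_eq_iff)
  ultimately show "\<exists>Y\<in>carrier (BS p q). Y \<otimes>\<^bsub>BS p q\<^esub> X = \<one>\<^bsub>BS p q\<^esub>"
    by (intro bexI[of _ "bs_elem p q (map inv_letter (rev w))"]) auto
qed auto

definition horocyclic :: "nat \<Rightarrow> nat \<Rightarrow> word \<Rightarrow> bool" where
  "horocyclic p q w \<longleftrightarrow> bs_elem p q w \<in> generate (BS p q) {bs_elem p q [Pos_a]}"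


section \<open>The length-lexicographical normal form\<close>

fun letter_code :: "letter \<Rightarrow> nat" where
  "letter_code Pos_t = 0"
| "letter_code Neg_t = 1"
| "letter_code Pos_a = 2"
| "letter_code Neg_a = 3"

lemma inj_letter_code: "inj letter_code"
proof (rule injI)
  show "x = y" if "letter_code x = letter_code y" for x y
    using that by (cases x; cases y) auto
qed

text \<open>\<open>measure letter_code\<close> is the strict order \<open>t < T < a < A\<close>; the library's \<^const>\<open>lenlex\<close>
  compares lengths first.\<close>

definition llex :: "(word \<times> word) set" where
  "llex = lenlex (measure letter_code)"

definition llnf :: "nat \<Rightarrow> nat \<Rightarrow> word \<Rightarrow> word" where
  "llnf p q w = (THE v. bs_eq p q v w \<and> (\<forall>u. bs_eq p q u w \<longrightarrow> u = v \<or> (v, u) \<in> llex))"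

lemma wf_llex: "wf llex"
  by (auto simp: llex_def)

lemma total_llex: "total llex"
  unfolding llex_def
proof (rule total_lenlex)
  show "total (measure letter_code)"
    unfolding total_on_def in_measure by (metis inj_letter_code injD linorder_less_linear)
qed

lemma llnf_ex1: "\<exists>!v. bs_eq p q v w \<and> (\<forall>u. bs_eq p q u w \<longrightarrow> u = v \<or> (v, u) \<in> llex)"
proof -
  have "w \<in> {v. bs_eq p q v w}" by (simp add: bs_eq.refl)
  then obtain v where v: "bs_eq p q v w" "\<And>u. (u, v) \<in> llex \<Longrightarrow> \<not> bs_eq p q u w"
    using wfE_min[OF wf_llex] by (metis mem_Collect_eq)
  show ?thesis
  proof (rule ex1I[of _ v])
    show "bs_eq p q v w \<and> (\<forall>u. bs_eq p q u w \<longrightarrow> u = v \<or> (v, u) \<in> llex)"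
      using v total_llex unfolding total_on_def by blast
  next
    fix v' assume "bs_eq p q v' w \<and> (\<forall>u. bs_eq p q u w \<longrightarrow> u = v' \<or> (v', u) \<in> llex)"
    with v show "v' = v" by metis
  qed
qed


section \<open>Random access programs with unit-cost integer arithmetic\<close>

text \<open>Programs work on finitely many integer registers and integer arrays with indirect
  addressing. Each arithmetic operation on (arbitrarily large) integers, each comparison and
  each memory access costs one time unit.\<close>

datatype aexp =
    Num int
  | Reg string
  | Cell string aexp
  | Plus aexp aexp
  | Minus aexp aexp
  | Times aexp aexp
  | Quot aexp aexp
  | Rem aexp aexp

datatype bexp =
    Less aexp aexp
  | Equal aexp aexp
  | Not bexp
  | And bexp bexp

datatype com =
    Skip
  | Assign string aexp
  | Store string aexp aexp
  | Seq com com
  | If bexp com com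
  | While bexp com

record state =
  regs :: "string \<Rightarrow> int"
  arrs :: "string \<Rightarrow> int \<Rightarrow> int"

fun aval :: "aexp \<Rightarrow> state \<Rightarrow> int" where
  "aval (Num n) s = n"
| "aval (Reg x) s = regs s x"
| "aval (Cell x i) s = arrs s x (aval i s)"
| "aval (Plus e f) s = aval e s + aval f s"
| "aval (Minus e f) s = aval e s - aval f s"
| "aval (Times e f) s = aval e s * aval f s"
| "aval (Quot e f) s = aval e s div aval f s"
| "aval (Rem e f) s = aval e s mod aval f s"

fun bval :: "bexp \<Rightarrow> state \<Rightarrow> bool" where
  "bval (Less e f) s \<longleftrightarrow> aval e s < aval f s"
| "bval (Equal e f) s \<longleftrightarrow> aval e s = aval f s"
| "bval (Not b) s \<longleftrightarrow> \<not> bval b s"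
| "bval (And b c) s \<longleftrightarrow> bval b s \<and> bval c s"

fun acost :: "aexp \<Rightarrow> nat" where
  "acost (Num n) = 1"
| "acost (Reg x) = 1"
| "acost (Cell x i) = acost i + 1"
| "acost (Plus e f) = acost e + acost f + 1"
| "acost (Minus e f) = acost e + acost f + 1"
| "acost (Times e f) = acost e + acost f + 1"
| "acost (Quot e f) = acost e + acost f + 1"
| "acost (Rem e f) = acost e + acost f + 1"

fun bcost :: "bexp \<Rightarrow> nat" where
  "bcost (Less e f) = acost e + acost f + 1"
| "bcost (Equal e f) = acost e + acost f + 1"
| "bcost (Not b) = bcost b + 1"
| "bcost (And b c) = bcost b + bcost c + 1"

text \<open>\<open>exec c s n s'\<close>: started in \<open>s\<close>, the program \<open>c\<close> terminates in \<open>s'\<close> after time \<open>n\<close>.\<close>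

inductive exec :: "com \<Rightarrow> state \<Rightarrow> nat \<Rightarrow> state \<Rightarrow> bool" where
  Skip: "exec Skip s 1 s"
| Assign: "exec (Assign x e) s (acost e + 1) (s\<lparr>regs := (regs s)(x := aval e s)\<rparr>)"
| Store: "exec (Store x i e) s (acost i + acost e + 1)
    (s\<lparr>arrs := (arrs s)(x := (arrs s x)(aval i s := aval e s))\<rparr>)"
| Seq: "exec c s m s' \<Longrightarrow> exec d s' n s'' \<Longrightarrow> exec (Seq c d) s (m + n) s''"
| IfTrue: "bval b s \<Longrightarrow> exec c s n s' \<Longrightarrow> exec (If b c d) s (bcost b + n + 1) s'"
| IfFalse: "\<not> bval b s \<Longrightarrow> exec d s n s' \<Longrightarrow> exec (If b c d) s (bcost b + n + 1) s'"
| WhileFalse: "\<not> bval b s \<Longrightarrow> exec (While b c) s (bcost b + 1) s"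
| WhileTrue: "bval b s \<Longrightarrow> exec c s m s' \<Longrightarrow> exec (While b c) s' n s'' \<Longrightarrow>
    exec (While b c) s (bcost b + m + n + 1) s''"

inductive_cases exec_SkipE: "exec Skip s n s'"
  and exec_AssignE: "exec (Assign x e) s n s'"
  and exec_StoreE: "exec (Store x i e) s n s'"
  and exec_SeqE: "exec (Seq c d) s n s'"
  and exec_IfE: "exec (If b c d) s n s'"
  and exec_WhileE: "exec (While b c) s n s'"

lemma exec_deterministic:
  "exec c s n s' \<Longrightarrow> exec c s m s'' \<Longrightarrow> s'' = s' \<and> m = n"
proof (induction arbitrary: m s'' rule: exec.induct)
  case Skip
  then show ?case by (rule exec_SkipE) simp
next
  case Assign
  then show ?case by (rule exec_AssignE) simp
next
  case Store
  then show ?case by (rule exec_StoreE) simp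
next
  case Seq
  from Seq.prems show ?case by (rule exec_SeqE) (metis Seq.IH)
next
  case IfTrue
  from IfTrue.prems show ?case by (rule exec_IfE) (metis Suc_eq_plus1 IfTrue.hyps(1) IfTrue.IH)+
next
  case IfFalse
  from IfFalse.prems show ?case by (rule exec_IfE) (metis Suc_eq_plus1 IfFalse.hyps(1) IfFalse.IH)+
next
  case WhileFalse
  from WhileFalse.prems show ?case by (rule exec_WhileE) (metis Suc_eq_plus1 WhileFalse.hyps(1))+
next
  case WhileTrue
  from WhileTrue.prems show ?case
    by (rule exec_WhileE) (metis Suc_eq_plus1 WhileTrue.hyps(1) WhileTrue.IH)+
qed

text \<open>A word is handed over letter by letter in an array, its length in a register; all other
  memory is initially zero.\<close>

definition input_state :: "word \<Rightarrow> state" where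
  "input_state w =
     \<lparr>regs = (\<lambda>_. 0)(''in'' := int (length w)),
      arrs = (\<lambda>_ _. 0)(''in'' :=
        (\<lambda>i. if 0 \<le> i \<and> i < int (length w) then int (letter_code (w ! nat i)) else 0))\<rparr>"

definition outputs :: "state \<Rightarrow> word \<Rightarrow> bool" where
  "outputs s v \<longleftrightarrow> regs s ''out'' = int (length v) \<and>
     (\<forall>i < length v. arrs s ''out'' (int i) = int (letter_code (v ! i)))"

lemma outputs_unique: "outputs s u \<Longrightarrow> outputs s v \<Longrightarrow> u = v"
  unfolding outputs_def by (intro nth_equalityI) (simp_all add: inj_eq[OF inj_letter_code])

definition linear_time_computable_on :: "word set \<Rightarrow> (word \<Rightarrow> word) \<Rightarrow> bool" where
  "linear_time_computable_on D f \<longleftrightarrow>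
     (\<exists>c K. \<forall>w\<in>D. \<exists>n s. exec c (input_state w) n s \<and> outputs s (f w) \<and> n \<le> K * (length w + 1))"

end

theory Submission
  imports Defs
begin

text \<open>
  A horocyclic word \<open>w\<close> equals a power \<open>a\<^sup>n\<close>. To find \<open>n\<close>, read \<open>w\<close> letter by letter and maintain
  the normal form of the prefix in the HNN extension as a stack of stable letters and remainders.
  Each letter takes a bounded number of operations. The updates define an action of the group on
  reduced normal forms (\<open>cross_shift_cross\<close>, \<open>act_cong\<close>), so at the end the stack is empty and the
  remaining exponent is \<open>n\<close> (\<open>represents_iff\<close>).

  The least word for \<open>a\<^sup>n\<close> is \<open>a\<^sup>n\<close> itself with \<open>|n| < 3 q\<close>, or \<open>t v T a\<^sup>r\<close> with \<open>n = q m + r\<close>,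
  \<open>|r| < q\<close> and \<open>v\<close> least for \<open>a\<^bsup>pm\<^esup>\<close> (\<open>least_wordE\<close>). Indeed, a word for a power of \<open>a\<close> is a product
  of letters \<open>a\<close>, \<open>A\<close> and excursions \<open>t v T\<close>, \<open>T v t\<close> (\<open>represents_stable_ConsE\<close>). These blocks
  commute, so excursions \<open>t v T\<close> can be merged and moved to the front, and an excursion \<open>T v t\<close>
  never pays because \<open>p < q\<close>.

  It remains to choose the exponents \<open>r\<close>. They are bounded, so the exponents that can occur at depth
  \<open>d\<close> of this recursion lie in a window of \<open>q + 1\<close> values starting at the number obtained from \<open>n\<close> by
  always rounding down (\<open>carry_bounds\<close>). Depth \<open>|w|\<close> suffices, as the least word is no longer than
  \<open>w\<close>. Dynamic programming over a table with \<open>|w| + 1\<close> rows of \<open>q + 1\<close> words therefore finds the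
  least word (\<open>correct_row_extend\<close>, \<open>correct_row_0\<close>). A row takes constant time, since words are
  stored as numbers in base 4 in such a way that the length-lexicographical order is the order of
  integers (\<open>llex_imp_enc_less\<close>).

  The program consists of loops that are not nested, with at most \<open>|w| + 1\<close> rounds each, over
  bodies whose size depends on \<open>p\<close> and \<open>q\<close> only. So its running time is linear.
\<close>

section \<open>Normal forms in the Baumslag-Solitar group\<close>

fun stable :: "bool \<Rightarrow> letter" where
  "stable True = Pos_t"
| "stable False = Neg_t"

definition apow :: "int \<Rightarrow> word" where
  "apow n = (if 0 \<le> n then replicate (nat n) Pos_a else replicate (nat (- n)) Neg_a)"

lemma apow_0 [simp]: "apow 0 = []"
  by (simp add: apow_def)

lemma length_apow [simp]: "length (apow n) = nat \<bar>n\<bar>"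
  by (simp add: apow_def)

lemma inv_stable [simp]: "inv_letter (stable e) = stable (\<not> e)"
  by (cases e) auto

locale baumslag_solitar =
  fixes p q :: nat
  assumes p_pos: "1 \<le> p" and p_less_q: "p < q"
begin

abbreviation bs_equal :: "word \<Rightarrow> word \<Rightarrow> bool" (infix "\<approx>" 50) where
  "u \<approx> v \<equiv> bs_eq p q u v"

declare bs_eq.trans [trans]

lemma bs_eq_context: "u \<approx> v \<Longrightarrow> x @ u @ y \<approx> x @ v @ y"
  by (intro bs_eq.append bs_eq.refl)

lemma bs_eq_left: "u \<approx> v \<Longrightarrow> x @ u \<approx> x @ v"
  by (intro bs_eq.append bs_eq.refl)

lemma bs_eq_right: "u \<approx> v \<Longrightarrow> u @ y \<approx> v @ y"
  by (intro bs_eq.append bs_eq.refl)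

lemma Cons_Pos_a_apow: "Pos_a # apow n \<approx> apow (n + 1)"
proof (cases "0 \<le> n")
  case True
  then show ?thesis by (simp add: apow_def bs_eq.refl nat_add_distrib)
next
  case False
  then have "nat (- n) = Suc (nat (- (n + 1)))" by simp
  then have "apow n = Neg_a # apow (n + 1)" using False by (auto simp: apow_def)
  moreover have "[Pos_a, Neg_a] @ apow (n + 1) \<approx> [] @ apow (n + 1)"
    using bs_eq.cancel[of p q Pos_a] by (intro bs_eq_right) simp
  ultimately show ?thesis by simp
qed

lemma Cons_Neg_a_apow: "Neg_a # apow n \<approx> apow (n - 1)"
proof (cases "n \<le> 0")
  case True
  then have "nat (- (n - 1)) = Suc (nat (- n))" by simp
  then show ?thesis using True by (cases "n = 0") (simp_all add: apow_def bs_eq.refl)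
next
  case False
  then have "nat n = Suc (nat (n - 1))" by simp
  then have "apow n = Pos_a # apow (n - 1)" using False by (simp add: apow_def)
  moreover have "[Neg_a, Pos_a] @ apow (n - 1) \<approx> [] @ apow (n - 1)"
    using bs_eq.cancel[of p q Neg_a] by (intro bs_eq_right) simp
  ultimately show ?thesis by simp
qed

lemma replicate_append_apow:
  "replicate m Pos_a @ apow n \<approx> apow (int m + n)"
  "replicate m Neg_a @ apow n \<approx> apow (n - int m)"
proof (induction m)
  case (Suc m)
  {
    case 1
    have "Pos_a # replicate m Pos_a @ apow n \<approx> Pos_a # apow (int m + n)"
      using bs_eq_left[OF Suc(1), of "[Pos_a]"] by simp
    also have "\<dots> \<approx> apow (int m + n + 1)" by (rule Cons_Pos_a_apow)
    finally show ?case by (simp add: algebra_simps)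
  next
    case 2
    have "Neg_a # replicate m Neg_a @ apow n \<approx> Neg_a # apow (n - int m)"
      using bs_eq_left[OF Suc(2), of "[Neg_a]"] by simp
    also have "\<dots> \<approx> apow (n - int m - 1)" by (rule Cons_Neg_a_apow)
    finally show ?case by (simp add: algebra_simps)
  }
qed (simp_all add: bs_eq.refl)

lemma apow_append: "apow m @ apow n \<approx> apow (m + n)"
proof (cases "0 \<le> m")
  case True
  then show ?thesis
    using replicate_append_apow(1)[of "nat m" n] by (simp add: apow_def[of m])
next
  case False
  then show ?thesis
    using replicate_append_apow(2)[of "nat (- m)" n] by (simp add: apow_def[of m] algebra_simps)
qed

text \<open>Both edge groups have finite index in \<open>\<langle>a\<rangle>\<close>. Indexing by the direction of the stable
  letter turns \<open>t a\<^sup>p = a\<^sup>q t\<close> and \<open>T a\<^sup>q = a\<^sup>p T\<close> into one law (\<open>stable_apow\<close>), so that normal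
  forms treat \<open>t\<close> and \<open>T\<close> alike.\<close>

definition edge_index :: "bool \<Rightarrow> int" where
  "edge_index e = (if e then int q else int p)"

lemma edge_index_pos: "0 < edge_index e"
  using p_pos p_less_q by (auto simp: edge_index_def)

lemma Pos_t_apow_nat: "Pos_t # apow (int p * int j) \<approx> apow (int q * int j) @ [Pos_t]"
proof (induction j)
  case 0
  show ?case by (simp add: bs_eq.refl)
next
  case (Suc j)
  let ?P = "apow (int p)" and ?Q = "apow (int q)"
  have P: "?P = replicate p Pos_a" and Q: "?Q = replicate q Pos_a"
    by (simp_all add: apow_def)
  have "[Pos_t] @ ?P @ [] \<approx> [Pos_t] @ ?P @ [Neg_t, Pos_t]"
    using bs_eq.sym[OF bs_eq.cancel[of p q Neg_t]] by (intro bs_eq_left) simp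
  also have "\<dots> = ([Pos_t] @ ?P @ [Neg_t]) @ [Pos_t]" by simp
  also have "\<dots> \<approx> ?Q @ [Pos_t]"
    unfolding P Q by (intro bs_eq_right bs_eq.relator)
  finally have one: "[Pos_t] @ ?P \<approx> ?Q @ [Pos_t]" by simp
  have "Pos_t # apow (int p * int (Suc j)) \<approx> Pos_t # (?P @ apow (int p * int j))"
    using bs_eq_left[OF bs_eq.sym[OF apow_append[of "int p" "int p * int j"]], of "[Pos_t]"]
    by (simp add: algebra_simps)
  also have "\<dots> = ([Pos_t] @ ?P) @ apow (int p * int j)" by simp
  also have "\<dots> \<approx> (?Q @ [Pos_t]) @ apow (int p * int j)" by (rule bs_eq_right[OF one])
  also have "\<dots> = ?Q @ (Pos_t # apow (int p * int j))" by simp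
  also have "\<dots> \<approx> ?Q @ (apow (int q * int j) @ [Pos_t])" by (rule bs_eq_left[OF Suc])
  also have "\<dots> = (?Q @ apow (int q * int j)) @ [Pos_t]" by simp
  also have "\<dots> \<approx> apow (int q + int q * int j) @ [Pos_t]" by (rule bs_eq_right[OF apow_append])
  finally show ?case by (simp add: algebra_simps)
qed

lemma Pos_t_apow: "Pos_t # apow (int p * j) \<approx> apow (int q * j) @ [Pos_t]"
proof (cases "0 \<le> j")
  case True
  then show ?thesis using Pos_t_apow_nat[of "nat j"] by simp
next
  case False
  let ?P = "apow (int p * j)" and ?Q = "apow (int q * j)"
  let ?P' = "apow (int p * - j)" and ?Q' = "apow (int q * - j)"
  have pos: "[Pos_t] @ ?P' \<approx> ?Q' @ [Pos_t]" using False Pos_t_apow_nat[of "nat (- j)"] by simp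
  have "Pos_t # ?P = apow 0 @ [Pos_t] @ ?P" by simp
  also have "\<dots> \<approx> (?Q @ ?Q') @ [Pos_t] @ ?P"
    using bs_eq.sym[OF apow_append[of "int q * j" "int q * - j"]] by (intro bs_eq_right) simp
  also have "\<dots> = ?Q @ (?Q' @ [Pos_t]) @ ?P" by simp
  also have "\<dots> \<approx> ?Q @ ([Pos_t] @ ?P') @ ?P" by (rule bs_eq_context[OF bs_eq.sym[OF pos]])
  also have "\<dots> = (?Q @ [Pos_t]) @ (?P' @ ?P)" by simp
  also have "\<dots> \<approx> (?Q @ [Pos_t]) @ apow 0"
    using apow_append[of "int p * - j" "int p * j"] by (intro bs_eq_left) simp
  finally show ?thesis by simp
qed

lemma stable_apow: "stable e # apow (edge_index (\<not> e) * j) \<approx> apow (edge_index e * j) @ [stable e]"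
proof (cases e)
  case True
  then show ?thesis using Pos_t_apow by (simp add: edge_index_def)
next
  case False
  let ?P = "apow (int p * j)" and ?Q = "apow (int q * j)"
  have "Neg_t # ?Q = ([Neg_t] @ ?Q) @ []" by simp
  also have "\<dots> \<approx> ([Neg_t] @ ?Q) @ [Pos_t, Neg_t]"
    using bs_eq.sym[OF bs_eq.cancel[of p q Pos_t]] by (intro bs_eq_left) simp
  also have "\<dots> = [Neg_t] @ (?Q @ [Pos_t]) @ [Neg_t]" by simp
  also have "\<dots> \<approx> [Neg_t] @ (Pos_t # ?P) @ [Neg_t]"
    by (rule bs_eq_context[OF bs_eq.sym[OF Pos_t_apow]])
  also have "\<dots> = [Neg_t, Pos_t] @ (?P @ [Neg_t])" by simp
  also have "\<dots> \<approx> [] @ (?P @ [Neg_t])"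
    using bs_eq.cancel[of p q Neg_t] by (intro bs_eq_right) simp
  finally show ?thesis using False by (simp add: edge_index_def)
qed

text \<open>The pair \<open>([(s\<^sub>m, e\<^sub>m), \<dots>, (s\<^sub>1, e\<^sub>1)], k)\<close> stands for the product
  \<open>a\<^bsup>s\<^sub>1\<^esup> x\<^sub>1 \<dots> a\<^bsup>s\<^sub>m\<^esup> x\<^sub>m a\<^bsup>k\<^esup>\<close> with stable letters \<open>x\<^sub>i\<close>; the list is a stack whose
  top comes first, because letters are multiplied from the right.\<close>

type_synonym normal_form = "(int \<times> bool) list \<times> int"

text \<open>Right multiplication by a stable letter \<open>x\<close>. If the top letter is opposite and the exponent
  between the two lies in the edge group, they form a pinch and disappear. Otherwise
  \<open>a\<^sup>k x = a\<^sup>r x a\<^sup>l\<close>, where \<open>r\<close> is the remainder of \<open>k\<close> and \<open>l\<close> its rescaled quotient; keeping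
  only remainders on the stack is what makes the form unique.\<close>

fun cross :: "bool \<Rightarrow> normal_form \<Rightarrow> normal_form" where
  "cross e (st, k) =
    (if st \<noteq> [] \<and> snd (hd st) \<noteq> e \<and> k mod edge_index e = 0
     then (tl st, fst (hd st) + edge_index (\<not> e) * (k div edge_index e))
     else ((k mod edge_index e, e) # st, edge_index (\<not> e) * (k div edge_index e)))"

fun shift :: "int \<Rightarrow> normal_form \<Rightarrow> normal_form" where
  "shift j (st, k) = (st, k + j)"

fun step :: "letter \<Rightarrow> normal_form \<Rightarrow> normal_form" where
  "step Pos_t = cross True"
| "step Neg_t = cross False"
| "step Pos_a = shift 1"
| "step Neg_a = shift (- 1)"

lemma step_stable [simp]: "step (stable e) = cross e"
  by (cases e) auto

abbreviation act :: "word \<Rightarrow> normal_form \<Rightarrow> normal_form" where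
  "act w \<equiv> fold step w"

text \<open>Remainders, and no pinch: between opposite stable letters the exponent, being a remainder, is in
  the edge group only if it is 0.\<close>

fun reduced :: "(int \<times> bool) list \<Rightarrow> bool" where
  "reduced [] \<longleftrightarrow> True"
| "reduced ((s, e) # st) \<longleftrightarrow> 0 \<le> s \<and> s < edge_index e \<and>
     (st \<noteq> [] \<and> snd (hd st) \<noteq> e \<longrightarrow> s \<noteq> 0) \<and> reduced st"

lemma reduced_cross: "reduced (fst s) \<Longrightarrow> reduced (fst (cross e s))"
proof (cases s)
  case (Pair st k)
  assume "reduced (fst s)"
  then show ?thesis
    using edge_index_pos[of e] by (cases st) (auto simp: Pair)
qed

lemma reduced_step: "reduced (fst s) \<Longrightarrow> reduced (fst (step x s))"
  by (cases x; cases s) (use reduced_cross in \<open>simp_all del: cross.simps\<close>)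

lemma reduced_act: "reduced (fst s) \<Longrightarrow> reduced (fst (act w s))"
  by (induction w arbitrary: s) (auto simp: reduced_step)

text \<open>For \<open>j = 0\<close> this says that opposite stable letters cancel, for \<open>j = 1\<close> that the defining
  relator is respected. Hence the words act on reduced normal forms through the group. The two
  cases are mirror images: what one crossing pushes, the opposite one pops, and conversely. In the
  first case reducedness enters: after popping, the remainder \<open>r\<close> cannot form another pinch.\<close>

lemma cross_shift_cross:
  assumes "reduced (fst s)"
  shows "cross (\<not> e) (shift (edge_index (\<not> e) * j) (cross e s)) = shift (edge_index e * j) s"
proof -
  obtain st k where s: "s = (st, k)" by fastforce
  define M N where "M = edge_index e" and "N = edge_index (\<not> e)"
  have pos: "0 < M" "0 < N" by (simp_all add: M_def N_def edge_index_pos)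
  show ?thesis
  proof (cases "st \<noteq> [] \<and> snd (hd st) \<noteq> e \<and> k mod M = 0")
    case True
    then obtain r st' where st: "st = (r, \<not> e) # st'" by (cases st) auto
    have r: "0 \<le> r" "r < N" and nz: "st' \<noteq> [] \<Longrightarrow> snd (hd st') = e \<Longrightarrow> r \<noteq> 0"
      using assms by (auto simp: s st N_def)
    have eq: "r + N * (k div M) + N * j = r + N * (k div M + j)" by (simp add: algebra_simps)
    have md: "(r + N * (k div M) + N * j) mod N = r" "(r + N * (k div M) + N * j) div N = k div M + j"
      using r pos unfolding eq by simp_all
    have k: "M * (k div M) = k" using True by (metis add.right_neutral mult_div_mod_eq)
    have "cross e s = (st', r + N * (k div M))"
      using True by (simp add: s st flip: M_def N_def)
    moreover have "cross (\<not> e) (st', r + N * (k div M) + N * j) = ((r, \<not> e) # st', M * (k div M + j))"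
    proof -
      have "\<not> (st' \<noteq> [] \<and> snd (hd st') \<noteq> (\<not> e) \<and> (r + N * (k div M) + N * j) mod N = 0)"
        using nz unfolding md by auto
      then show ?thesis
        unfolding cross.simps N_def[symmetric] not_not M_def[symmetric] by (simp only: if_False md)
    qed
    ultimately show ?thesis
      using k by (simp add: s st algebra_simps flip: M_def N_def)
  next
    case False
    have "N * (k div M) + N * j = N * (k div M + j)" by (simp add: algebra_simps)
    then have md: "(N * (k div M) + N * j) mod N = 0" "(N * (k div M) + N * j) div N = k div M + j"
      using pos by simp_all
    have k: "k mod M + M * (k div M + j) = k + M * j"
      by (simp add: algebra_simps)
    have "cross e s = ((k mod M, e) # st, N * (k div M))"
      using False by (auto simp: s simp flip: M_def N_def)
    then show ?thesis
      by (simp add: s md k flip: M_def N_def)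
  qed
qed

lemma shift_shift [simp]: "shift i (shift j s) = shift (i + j) s"
  by (cases s) simp

lemma shift_0 [simp]: "shift 0 s = s"
  by (cases s) simp

lemma funpow_shift [simp]: "(shift j ^^ n) s = shift (int n * j) s"
  by (induction n) (simp_all add: algebra_simps)

lemma act_apow [simp]: "act (apow n) s = shift n s"
  by (simp add: apow_def)

lemma step_inv_step: "reduced (fst s) \<Longrightarrow> step (inv_letter x) (step x s) = s"
  using cross_shift_cross[of s True 0] cross_shift_cross[of s False 0]
  by (cases x) (simp_all del: cross.simps)

text \<open>Equal words act equally, so the form reached from \<open>([], 0)\<close> is an invariant of the group element.
  This replaces Britton's lemma.\<close>

lemma act_cong: "u \<approx> v \<Longrightarrow> reduced (fst s) \<Longrightarrow> act u s = act v s"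
proof (induction arbitrary: s rule: bs_eq.induct)
  case (append u u' v v')
  then show ?case by (simp add: reduced_act)
next
  case (cancel x)
  then show ?case by (simp add: step_inv_step)
next
  case relator
  then show ?case
    using cross_shift_cross[of s True 1]
    by (simp add: edge_index_def del: cross.simps)
qed simp_all

fun stack_word :: "(int \<times> bool) list \<Rightarrow> word" where
  "stack_word [] = []"
| "stack_word ((s, e) # st) = stack_word st @ apow s @ [stable e]"

definition nf_word :: "normal_form \<Rightarrow> word" where
  "nf_word s = stack_word (fst s) @ apow (snd s)"

lemma nf_word_cross: "nf_word s @ [stable e] \<approx> nf_word (cross e s)"
proof -
  obtain st k where s: "s = (st, k)" by fastforce
  define M N where "M = edge_index e" and "N = edge_index (\<not> e)"
  have move: "apow (M * j) @ [stable e] \<approx> stable e # apow (N * j)" for j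
    using stable_apow[of e j] by (auto simp: M_def N_def intro: bs_eq.sym)
  show ?thesis
  proof (cases "st \<noteq> [] \<and> snd (hd st) \<noteq> e \<and> k mod M = 0")
    case True
    then obtain r st' where st: "st = (r, \<not> e) # st'" by (cases st) auto
    have k: "M * (k div M) = k" using True by (metis add.right_neutral mult_div_mod_eq)
    let ?R = "stack_word st' @ apow r"
    have "nf_word s @ [stable e] = (?R @ [stable (\<not> e)]) @ (apow (M * (k div M)) @ [stable e])"
      by (simp add: s st nf_word_def k)
    also have "\<dots> \<approx> (?R @ [stable (\<not> e)]) @ (stable e # apow (N * (k div M)))"
      by (rule bs_eq_left[OF move])
    also have "\<dots> = ?R @ [stable (\<not> e), stable e] @ apow (N * (k div M))" by simp
    also have "\<dots> \<approx> ?R @ [] @ apow (N * (k div M))"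
      using bs_eq.cancel[of p q "stable (\<not> e)"] by (intro bs_eq_context) simp
    also have "\<dots> = stack_word st' @ (apow r @ apow (N * (k div M)))" by simp
    also have "\<dots> \<approx> stack_word st' @ apow (r + N * (k div M))"
      by (rule bs_eq_left[OF apow_append])
    also have "\<dots> = nf_word (cross e s)"
      using True by (simp add: s st nf_word_def flip: M_def N_def)
    finally show ?thesis .
  next
    case False
    have "nf_word s @ [stable e] = stack_word st @ apow k @ [stable e]"
      by (simp add: s nf_word_def)
    also have "\<dots> \<approx> stack_word st @ (apow (k mod M) @ apow (M * (k div M))) @ [stable e]"
      using bs_eq.sym[OF apow_append[of "k mod M" "M * (k div M)"]]
      by (intro bs_eq_context) simp
    also have "\<dots> = (stack_word st @ apow (k mod M)) @ (apow (M * (k div M)) @ [stable e])" by simp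
    also have "\<dots> \<approx> (stack_word st @ apow (k mod M)) @ (stable e # apow (N * (k div M)))"
      by (rule bs_eq_left[OF move])
    also have "\<dots> = nf_word (cross e s)"
      using False by (auto simp: s nf_word_def simp flip: M_def N_def)
    finally show ?thesis .
  qed
qed

lemma nf_word_step: "nf_word s @ [x] \<approx> nf_word (step x s)"
proof (cases x)
  case Pos_t
  then show ?thesis using nf_word_cross[of s True] by simp
next
  case Neg_t
  then show ?thesis using nf_word_cross[of s False] by simp
next
  case Pos_a
  then show ?thesis
    using bs_eq_left[OF apow_append[of "snd s" 1], of "stack_word (fst s)"]
    by (cases s) (simp add: nf_word_def apow_def[of 1])
next
  case Neg_a
  then show ?thesis
    using bs_eq_left[OF apow_append[of "snd s" "- 1"], of "stack_word (fst s)"]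
    by (cases s) (simp add: nf_word_def apow_def[of "- 1"])
qed

lemma nf_word_act: "nf_word s @ w \<approx> nf_word (act w s)"
proof (induction w arbitrary: s)
  case Nil
  show ?case by (simp add: bs_eq.refl)
next
  case (Cons x w)
  have "nf_word s @ x # w = (nf_word s @ [x]) @ w" by simp
  also have "\<dots> \<approx> nf_word (step x s) @ w" by (rule bs_eq_right[OF nf_word_step])
  also have "\<dots> \<approx> nf_word (act w (step x s))" by (rule Cons)
  finally show ?case by simp
qed

definition represents :: "word \<Rightarrow> int \<Rightarrow> bool" where
  "represents w n \<longleftrightarrow> w \<approx> apow n"

text \<open>Whether a word represents a power of \<open>a\<close>, and which one, is thereby read off from one run over it.
  One direction is invariance; for the other, each step of the run is an equality in the group.\<close>

lemma represents_iff: "represents w n \<longleftrightarrow> act w ([], 0) = ([], n)"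
proof
  assume "represents w n"
  then show "act w ([], 0) = ([], n)"
    using act_cong[of w "apow n" "([], 0)"] by (simp add: represents_def)
next
  assume "act w ([], 0) = ([], n)"
  then show "represents w n"
    using nf_word_act[of "([], 0)" w] by (simp add: represents_def nf_word_def)
qed

lemma act_represents: "represents w n \<Longrightarrow> reduced st \<Longrightarrow> act w (st, k) = (st, k + n)"
  using act_cong[of w "apow n" "(st, k)"] by (simp add: represents_def)

lemma represents_apow [simp]: "represents (apow n) n"
  by (simp add: represents_def bs_eq.refl)

lemma represents_append: "represents u m \<Longrightarrow> represents v n \<Longrightarrow> represents (u @ v) (m + n)"
  by (simp add: represents_iff[of "u @ v"] act_represents)

text \<open>The prefix \<open>u\<close> moves the initial form exactly as \<open>a\<^sup>m\<close> does, so \<open>u\<close> can be exchanged for \<open>a\<^sup>m\<close>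
  and then cancelled.\<close>

lemma represents_cancel_left:
  assumes "represents (u @ v) n" and "represents u m"
  shows "represents v (n - m)"
proof -
  have "([], n) = act v (shift m ([], 0))"
    using assms by (simp add: represents_iff)
  also have "shift m ([], 0) = act (apow m) ([], 0)" by simp
  finally have "represents (apow m @ v) n" by (simp add: represents_iff)
  then have "represents (apow (- m) @ apow m @ v) (- m + n)"
    by (intro represents_append represents_apow)
  then show ?thesis by (simp add: represents_iff)
qed

lemma represents_block:
  assumes "represents w (edge_index (\<not> e) * m)"
  shows "represents (stable e # w @ [stable (\<not> e)]) (edge_index e * m)"
proof -
  have "reduced (fst (cross e ([], 0)))" by (rule reduced_cross) simp
  then have "act w (cross e ([], 0)) = shift (edge_index (\<not> e) * m) (cross e ([], 0))"
    using act_represents[OF assms] by (cases "cross e ([], 0)") (simp del: cross.simps)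
  then show ?thesis
    using cross_shift_cross[of "([], 0)" e m] by (simp add: represents_iff del: cross.simps)
qed

text \<open>While the base of the stack stays untouched, it has no influence on the run. The first letter
  that touches it can only be one that cancels its top.\<close>

lemma act_above_base:
  assumes "base \<noteq> []"
  shows "(\<exists>xs' k'. act v (xs @ base, k) = (xs' @ base, k')) \<or>
    (\<exists>v1 v2 k'. v = v1 @ stable (\<not> snd (hd base)) # v2 \<and> act v1 (xs, k) = ([], k') \<and>
       k' mod edge_index (\<not> snd (hd base)) = 0)"
proof (induction v arbitrary: xs k)
  case Nil
  then show ?case by auto
next
  case (Cons x v)
  let ?e = "\<not> snd (hd base)"
  show ?case
  proof (cases "xs = [] \<and> x = stable ?e \<and> k mod edge_index ?e = 0")
    case True
    then show ?thesis
      by (intro disjI2 exI[of _ "[]"] exI[of _ v] exI[of _ k]) simp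
  next
    case False
    obtain xs' k' where s: "step x (xs, k) = (xs', k')" by fastforce
    have st: "step x (xs @ base, k) = (xs' @ base, k')"
    proof (cases xs)
      case Nil
      then show ?thesis using s False assms by (cases x) (auto split: if_splits)
    next
      case Cons
      then show ?thesis using s by (cases x) (auto split: if_splits)
    qed
    from Cons[of xs' k'] show ?thesis
    proof (elim disjE exE conjE)
      fix xs'' k'' assume "act v (xs' @ base, k') = (xs'' @ base, k'')"
      then show ?thesis by (auto simp: st)
    next
      fix v1 v2 k''
      assume "v = v1 @ stable ?e # v2" "act v1 (xs', k') = ([], k'')" "k'' mod edge_index ?e = 0"
      then show ?thesis
        by (intro disjI2 exI[of _ "x # v1"] exI[of _ v2] exI[of _ k'']) (simp add: s)
    qed
  qed
qed

text \<open>A word for a power of \<open>a\<close> is a closed path in the Bass-Serre tree. The decomposition cuts it at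
  the first return to its starting point, where the letter that cancels the first one is read.\<close>

lemma represents_stable_ConsE:
  assumes "represents (stable e # u) n"
  obtains v1 v2 m where "u = v1 @ stable (\<not> e) # v2"
    and "represents v1 (edge_index (\<not> e) * m)" and "represents v2 (n - edge_index e * m)"
proof -
  have "act u ([] @ [(0, e)], 0) = ([], n)"
    using assms by (simp add: represents_iff)
  then have "\<not> (\<exists>xs' k'. act u ([] @ [(0, e)], 0) = (xs' @ [(0, e)], k'))" by simp
  note act_above_base[of "[(0, e)]" u "[]" 0, OF list.distinct(2), unfolded list.sel snd_conv disj_imp,
      THEN mp, OF this]
  then obtain v1 v2 k where u: "u = v1 @ stable (\<not> e) # v2" and v1: "act v1 ([], 0) = ([], k)"
    and "k mod edge_index (\<not> e) = 0"
    by (elim exE conjE)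
  from this(3) have "edge_index (\<not> e) dvd k" by (simp add: mod_eq_0_iff_dvd)
  then obtain m where k: "k = edge_index (\<not> e) * m" by (rule dvdE)
  have v1: "represents v1 (edge_index (\<not> e) * m)" using v1 k by (simp add: represents_iff)
  have "represents ((stable e # v1 @ [stable (\<not> e)]) @ v2) n" using assms u by simp
  then have "represents v2 (n - edge_index e * m)"
    using represents_block[OF v1] by (rule represents_cancel_left)
  with u v1 show ?thesis by (rule that)
qed

lemma horocyclic_imp_represents:
  assumes "horocyclic p q w"
  obtains n where "represents w n"
proof -
  interpret G: group "BS p q" by (rule group_BS)
  have apow1: "apow 1 = [Pos_a]" "apow (- 1) = [Neg_a]" by (simp_all add: apow_def)
  have inv_a: "inv\<^bsub>BS p q\<^esub> (bs_elem p q [Pos_a]) = bs_elem p q [Neg_a]"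
  proof (rule G.inv_equality)
    show "bs_elem p q [Neg_a] \<otimes>\<^bsub>BS p q\<^esub> bs_elem p q [Pos_a] = \<one>\<^bsub>BS p q\<^esub>"
      using bs_eq.cancel[of p q Neg_a] by (simp add: bs_elem_eq_iff)
  qed simp_all
  have "\<exists>n. X = bs_elem p q (apow n)" if "X \<in> generate (BS p q) {bs_elem p q [Pos_a]}" for X
    using that
  proof (induction rule: generate.induct)
    case one
    have "\<one>\<^bsub>BS p q\<^esub> = bs_elem p q (apow 0)" by simp
    then show ?case by (rule exI)
  next
    case (incl h)
    then have "h = bs_elem p q (apow 1)" by (simp add: apow1)
    then show ?case by (rule exI)
  next
    case (inv h)
    then have "inv\<^bsub>BS p q\<^esub> h = bs_elem p q (apow (- 1))" by (simp only: apow1 inv_a singleton_iff)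
    then show ?case by (rule exI)
  next
    case (eng h1 h2)
    from eng.IH obtain m n where "h1 = bs_elem p q (apow m)" "h2 = bs_elem p q (apow n)"
      by (elim exE)
    then have "h1 \<otimes>\<^bsub>BS p q\<^esub> h2 = bs_elem p q (apow (m + n))"
      using apow_append[of m n] by (simp only: mult_bs_elem bs_elem_eq_iff)
    then show ?case by (rule exI)
  qed
  from this[OF assms[unfolded horocyclic_def]] obtain n
    where "bs_elem p q w = bs_elem p q (apow n)" by (elim exE)
  then have "represents w n" by (simp only: bs_elem_eq_iff represents_def)
  then show ?thesis by (rule that)
qed

end

section \<open>Words as numbers\<close>

text \<open>The letters are the digits of numbers in base 4. Started with a leading digit 1, this maps words
  injectively to numbers whose order is first by length and then lexicographic
  (\<open>llex_imp_enc_less\<close>), so that a program compares two words by one comparison of integers and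
  appends a bounded number of letters by one multiplication and one addition.\<close>

definition push_digits :: "int \<Rightarrow> word \<Rightarrow> int" where
  "push_digits = (\<lambda>e w. fold (\<lambda>x e. 4 * e + int (letter_code x)) w e)"

abbreviation enc :: "word \<Rightarrow> int" where
  "enc \<equiv> push_digits 1"

lemma push_digits_Nil [simp]: "push_digits e [] = e"
  and push_digits_Cons [simp]: "push_digits e (x # w) = push_digits (4 * e + int (letter_code x)) w"
  and push_digits_append [simp]: "push_digits e (u @ v) = push_digits (push_digits e u) v"
  by (simp_all add: push_digits_def)

lemma letter_code_less: "letter_code x < 4"
  by (cases x) auto

lemma push_digits_eq: "push_digits e w = e * 4 ^ length w + push_digits 0 w"
proof (induction w rule: rev_induct)
  case (snoc x w)
  then show ?case by (simp add: algebra_simps)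
qed simp

lemma push_digits_0_bounds: "0 \<le> push_digits 0 w \<and> push_digits 0 w < 4 ^ length w"
proof (induction w rule: rev_induct)
  case (snoc x w)
  have "int (letter_code x) \<le> 3" using letter_code_less[of x] by simp
  with snoc show ?case by simp
qed simp

lemma enc_bounds: "4 ^ length w \<le> enc w" "enc w < 2 * 4 ^ length w"
  using push_digits_eq[of 1 w] push_digits_0_bounds[of w] by simp_all

lemma enc_pos: "0 < enc w"
  using enc_bounds(1)[of w] by (rule less_le_trans[rotated]) simp

lemma enc_less_length:
  assumes "length u < length v"
  shows "enc u < enc v"
proof -
  have "(4::int) ^ Suc (length u) \<le> 4 ^ length v"
    using assms by (intro power_increasing) auto
  then show ?thesis using enc_bounds[of u] enc_bounds[of v] by simp
qed

text \<open>The order is compatible with concatenation on both sides. Therefore every part of a least word is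
  itself least among the words equal to it.\<close>

lemma enc_context_less:
  assumes "enc u < enc v"
  shows "enc (x @ u @ y) < enc (x @ v @ y)"
proof -
  have "length u \<le> length v" using assms enc_less_length[of v u] by (meson less_asym not_le)
  then have "(enc x - 1) * 4 ^ length u \<le> (enc x - 1) * (4 ^ length v)"
    using enc_pos[of x] by (intro mult_left_mono power_increasing) auto
  moreover have "push_digits (enc x) w = (enc x - 1) * 4 ^ length w + enc w" for w
    using push_digits_eq[of "enc x" w] push_digits_eq[of 1 w] by (simp add: algebra_simps)
  ultimately have "push_digits (enc x) u < push_digits (enc x) v" using assms by simp
  then show ?thesis
    using push_digits_eq[of "push_digits (enc x) u" y] push_digits_eq[of "push_digits (enc x) v" y]
    by simp
qed

lemma enc_Cons_less:
  assumes "length u = length v" and "letter_code x < letter_code y"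
  shows "enc (x # u) < enc (y # v)"
proof -
  have "(4 + int (letter_code x) + 1) * 4 ^ length u \<le> (4 + int (letter_code y)) * (4::int) ^ length u"
    using assms(2) by (intro mult_right_mono) auto
  then show ?thesis
    using assms(1) push_digits_eq[of "4 + int (letter_code x)" u]
      push_digits_eq[of "4 + int (letter_code y)" v] push_digits_0_bounds[of u]
      push_digits_0_bounds[of v]
    by (simp add: algebra_simps)
qed

lemma llex_imp_enc_less:
  assumes "(u, v) \<in> llex"
  shows "enc u < enc v"
proof (cases "length u < length v")
  case True
  then show ?thesis by (rule enc_less_length)
next
  case False
  with assms have len: "length u = length v" and "(u, v) \<in> lex (measure letter_code)"
    by (auto simp: llex_def lenlex_conv)
  then obtain x a b y z where *: "u = x @ a # y" "v = x @ b # z" "letter_code a < letter_code b"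
    by (auto simp: lex_conv)
  with len have "enc (a # y) < enc (b # z)" by (intro enc_Cons_less) auto
  then show ?thesis using enc_context_less[of "a # y" "b # z" x "[]"] * by simp
qed

section \<open>The shape of least words\<close>

context baumslag_solitar
begin

definition least_word :: "word \<Rightarrow> int \<Rightarrow> bool" where
  "least_word u n \<longleftrightarrow> represents u n \<and> (\<forall>v. represents v n \<longrightarrow> enc u \<le> enc v)"

lemma least_word_le: "least_word u n \<Longrightarrow> represents v n \<Longrightarrow> enc u \<le> enc v"
  by (simp add: least_word_def)

lemma least_word_length_le: "least_word u n \<Longrightarrow> represents v n \<Longrightarrow> length u \<le> length v"
  using least_word_le[of u n v] enc_less_length[of v u] by (meson not_le)

lemma least_word_represents: "least_word u n \<Longrightarrow> represents u n"
  by (simp add: least_word_def)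

lemma llnf_unique_least:
  assumes "represents w n" and "least_word u n"
  shows "llnf p q w = u"
proof -
  have rep: "bs_eq p q v w \<longleftrightarrow> represents v n" for v
    using assms(1) by (meson bs_eq.sym bs_eq.trans represents_def)
  have "u = v \<or> (u, v) \<in> llex" if "represents v n" for v
    using that total_llex least_word_le[OF assms(2) that] llex_imp_enc_less[of v u]
    unfolding total_on_def by force
  then have "bs_eq p q u w \<and> (\<forall>v. bs_eq p q v w \<longrightarrow> v = u \<or> (u, v) \<in> llex)"
    using assms(2) by (auto simp: rep least_word_def)
  then show ?thesis
    unfolding llnf_def by (rule the1_equality[OF llnf_ex1])
qed

lemma least_word_exists:
  assumes "represents w n"
  obtains u where "least_word u n"
proof -
  obtain u where "represents u n" "\<And>v. (v, u) \<in> measure (nat \<circ> enc) \<Longrightarrow> \<not> represents v n"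
    using wfE_min[OF wf_measure, of w "{u. represents u n}" "nat \<circ> enc"] assms by auto
  then have "least_word u n"
    using enc_pos by (force simp: least_word_def not_less)
  then show ?thesis by (rule that)
qed

lemma represents_context:
  assumes "represents (x @ u @ y) n" and "represents u k" and "represents v k"
  shows "represents (x @ v @ y) n"
proof -
  have "v \<approx> u" using assms(2,3) by (meson bs_eq.sym bs_eq.trans represents_def)
  then have "x @ v @ y \<approx> x @ u @ y" by (rule bs_eq_context)
  with assms(1) show ?thesis by (meson bs_eq.trans represents_def)
qed

lemma least_word_infix:
  assumes "least_word (x @ u @ y) n" and "represents u k"
  shows "least_word u k"
  unfolding least_word_def
proof (intro conjI allI impI)
  fix v assume "represents v k"
  then have "represents (x @ v @ y) n"
    using assms by (auto intro: represents_context simp: least_word_def)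
  then have "enc (x @ u @ y) \<le> enc (x @ v @ y)" by (rule least_word_le[OF assms(1)])
  then show "enc u \<le> enc v" using enc_context_less[of v u x y] by (simp add: not_less[symmetric]) fastforce
qed (fact assms(2))

lemma represents_up:
  assumes "represents w (int p * m)"
  shows "represents (Pos_t # w @ Neg_t # apow r) (int q * m + r)"
  using represents_append[OF represents_block[of w True m] represents_apow[of r]] assms
  by (simp add: edge_index_def)

lemma represents_down:
  assumes "represents w (int q * m)"
  shows "represents (Neg_t # w @ [Pos_t]) (int p * m)"
  using represents_block[of w False m] assms by (simp add: edge_index_def)

text \<open>From \<open>3 q\<close> on, replacing \<open>a\<^bsup>3q\<^esup>\<close> by \<open>t a\<^bsup>3p\<^esup> T\<close> pays off: it saves \<open>3 (q - p) \<ge> 3\<close> letters \<open>a\<close>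
  and costs the two stable letters.\<close>

lemma least_apow_bound:
  assumes "least_word (apow n) n"
  shows "\<bar>n\<bar> < 3 * int q"
proof (rule ccontr)
  assume "\<not> ?thesis"
  moreover define m r where "m = 3 * sgn n" and "r = n - int q * m"
  ultimately have r: "\<bar>r\<bar> = \<bar>n\<bar> - 3 * int q" "\<bar>m\<bar> = 3"
    using p_less_q by (auto simp: sgn_if abs_if)
  have "represents (Pos_t # apow (int p * m) @ Neg_t # apow r) n"
    using represents_up[OF represents_apow, of m r] by (simp add: r_def)
  from least_word_length_le[OF assms this] show False
    using r p_less_q by (simp add: abs_mult nat_mult_distrib)
qed

text \<open>Moving \<open>a\<^bsup>q\<^esup>\<close> across \<open>T\<close> turns it into the shorter \<open>a\<^bsup>p\<^esup>\<close>, so a least word has no \<open>q\<close> letters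
  \<open>a\<close> of the same sign after \<open>T\<close>.\<close>

lemma least_up_bound:
  assumes "least_word (Pos_t # u @ Neg_t # apow r) n" and "represents u (int p * m)"
  shows "\<bar>r\<bar> < int q"
proof (rule ccontr)
  assume r: "\<not> ?thesis"
  define s where "s = sgn r"
  have s: "\<bar>int p * s\<bar> = int p" "\<bar>r - int q * s\<bar> = \<bar>r\<bar> - int q"
    using r p_less_q by (auto simp: sgn_if abs_if s_def)
  have n: "n = int q * m + r"
    using represents_up[OF assms(2), of r] least_word_represents[OF assms(1)]
    by (simp add: represents_iff)
  have "represents (u @ apow (int p * s)) (int p * (m + s))"
    using represents_append[OF assms(2) represents_apow[of "int p * s"]] by (simp add: algebra_simps)
  from represents_up[OF this, of "r - int q * s"]
  have "represents (Pos_t # (u @ apow (int p * s)) @ Neg_t # apow (r - int q * s)) n"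
    by (simp add: n algebra_simps)
  from least_word_length_le[OF assms(1) this] show False
    using r s p_less_q by simp
qed

text \<open>Only the outermost shape is recorded. That the inner word has such a shape again follows from its
  being least, by \<open>least_word_infix\<close>.\<close>

inductive normal_word :: "word \<Rightarrow> int \<Rightarrow> bool" where
  flat: "normal_word (apow n) n"
| up: "represents u (int p * m) \<Longrightarrow> normal_word (Pos_t # u @ Neg_t # apow r) (int q * m + r)"

text \<open>The induction looks at the first block of the word, a single \<open>a\<close> or \<open>A\<close> or an excursion that
  starts and ends with opposite stable letters, and applies the hypothesis to the rest. Powers of
  \<open>a\<close> commute, so a letter \<open>a\<close> or \<open>A\<close> before \<open>t\<close> could be put at the end, which is smaller as
  \<open>t\<close> is the smallest letter, and two excursions that start with \<open>t\<close> could share their stable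
  letters. An excursion \<open>T v t\<close> is never minimal: if \<open>v\<close> is a power of \<open>a\<close>, it shrinks when moved
  across the stable letter; otherwise \<open>v\<close> starts with \<open>t\<close>, and the bound on its last exponent
  together with divisibility by \<open>q\<close> forces it to end with \<open>T\<close>, so that letters cancel.\<close>

lemma least_word_normal: "least_word u n \<Longrightarrow> normal_word u n"
proof (induction "length u" arbitrary: u n rule: less_induct)
  case less
  note least = less.prems and rep = least_word_represents[OF less.prems]
  have sub: "normal_word v k" if "u = x @ v @ y" "x \<noteq> [] \<or> y \<noteq> []" "represents v k" for x v y k
    using that least by (intro less.hyps least_word_infix[of x v y]) auto
  have no_letter: "u = apow n"
    if u: "u = [x] @ v" and x: "(x = Pos_a \<and> d = 1) \<or> (x = Neg_a \<and> d = - 1)" for x v and d :: int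
  proof -
    have x_apow: "[x] = apow d" using x by (auto simp: apow_def)
    have "represents v (n - d)"
      using rep[unfolded u] by (rule represents_cancel_left) (simp add: x_apow)
    with u have "normal_word v (n - d)" by (intro sub[of "[x]" v "[]"]) auto
    then show ?thesis
    proof cases
      case flat
      \<comment> \<open>the first letter has the sign of the remaining exponent, since otherwise it would cancel\<close>
      have "1 + \<bar>n - d\<bar> \<le> \<bar>n\<bar>"
        using least_word_length_le[OF least represents_apow] u flat by simp
      then have "0 \<le> n - d \<and> d = 1 \<or> n - d \<le> 0 \<and> d = - 1" using x by auto
      then show ?thesis
      proof
        assume *: "0 \<le> n - d \<and> d = 1"
        then have "nat n = Suc (nat (n - d))" by arith
        then show ?thesis using * x u flat by (simp add: apow_def)
      next
        assume *: "n - d \<le> 0 \<and> d = - 1"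
        then have "nat (- n) = Suc (nat (- (n - d)))" by arith
        then show ?thesis using * x u flat by (cases "n - d = 0") (auto simp: apow_def)
      qed
    next
      case (up u' m r)
      have "represents (v @ [x]) n"
        using represents_append[OF \<open>represents v (n - d)\<close> represents_apow[of d]] x_apow by simp
      then have "enc u \<le> enc (v @ [x])" by (rule least_word_le[OF least])
      moreover have "enc (v @ [x]) < enc u"
        using enc_Cons_less[of "u' @ Neg_t # apow r @ [x]" v Pos_t x] x up(1) u by auto
      ultimately show ?thesis by simp
    qed
  qed
  show ?case
  proof (cases u)
    case Nil
    then have "n = 0" using rep by (simp add: represents_iff)
    then show ?thesis using Nil normal_word.flat[of 0] by simp
  next
    case (Cons x v)
    show ?thesis
    proof (cases x)
      case Pos_a
      then show ?thesis using no_letter[of x v 1] Cons normal_word.flat[of n] by simp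
    next
      case Neg_a
      then show ?thesis using no_letter[of x v "- 1"] Cons normal_word.flat[of n] by simp
    next
      case Pos_t
      then have "represents (stable True # v) n" using rep Cons by simp
      then obtain v1 v2 m where v: "v = v1 @ Neg_t # v2" and v1: "represents v1 (int p * m)"
        and v2: "represents v2 (n - int q * m)"
        by (rule represents_stable_ConsE) (simp add: edge_index_def)
      have "normal_word v2 (n - int q * m)"
        using v v2 Cons by (intro sub[of "x # v1 @ [Neg_t]" v2 "[]"]) auto
      then show ?thesis
      proof cases
        case flat
        then show ?thesis
          using normal_word.up[OF v1, of "n - int q * m"] Cons Pos_t v by simp
      next
        case (up u' m' r)
        have "represents (v1 @ u') (int p * (m + m'))"
          using represents_append[OF v1 up(3)] by (simp add: algebra_simps)
        from represents_up[OF this, of r] have "represents (Pos_t # (v1 @ u') @ Neg_t # apow r) n"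
          using up(2) by (simp add: algebra_simps)
        from least_word_length_le[OF least this] show ?thesis
          using Cons v up(1) by simp
      qed
    next
      case Neg_t
      then have "represents (stable False # v) n" using rep Cons by simp
      then obtain v1 v2 m where v: "v = v1 @ Pos_t # v2" and v1: "represents v1 (int q * m)"
        by (rule represents_stable_ConsE) (simp add: edge_index_def)
      have u: "u = [] @ (Neg_t # v1 @ [Pos_t]) @ v2" using Cons Neg_t v by simp
      have "least_word (Neg_t # v1 @ [Pos_t]) (int p * m)"
        using least unfolding u by (rule least_word_infix) (rule represents_down[OF v1])
      note short = least_word_length_le[OF this]
      have "normal_word v1 (int q * m)"
        using v v1 Cons by (intro sub[of "[x]" v1 "Pos_t # v2"]) auto
      then show ?thesis
      proof cases
        case flat
        have "int p * \<bar>m\<bar> \<le> int q * \<bar>m\<bar>"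
          using p_less_q by (intro mult_right_mono) auto
        then show ?thesis using short[OF represents_apow] flat by (simp add: abs_mult)
      next
        case (up u' m' r)
        have "least_word v1 (int q * m)"
          using least Cons v v1 by (intro least_word_infix[of "[x]" v1 "Pos_t # v2" n]) auto
        then have "\<bar>r\<bar> < int q" unfolding up(1) using up(3) by (rule least_up_bound)
        moreover have r: "r = int q * (m - m')" using up(2) by (simp add: algebra_simps)
        ultimately have "int q * \<bar>m - m'\<bar> < int q * 1" by (simp add: abs_mult)
        then have "\<bar>m - m'\<bar> < 1" using p_less_q by (subst (asm) mult_less_cancel_left_pos) auto
        then have "m = m'" by simp
        with up(3) have "represents u' (int p * m)" by simp
        from short[OF this] show ?thesis using up(1) by simp
      qed
    qed
  qed
qed

lemma least_wordE:
  assumes "least_word u n"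
  obtains "u = apow n" "\<bar>n\<bar> < 3 * int q"
  | v m r where "u = Pos_t # v @ Neg_t # apow r" "least_word v (int p * m)"
      "n = int q * m + r" "\<bar>r\<bar> < int q"
  using least_word_normal[OF assms]
proof cases
  case flat
  then show ?thesis using assms that(1) least_apow_bound by simp
next
  case (up v m r)
  have "least_word v (int p * m)"
    using assms up by (intro least_word_infix[of "[Pos_t]" v "Neg_t # apow r" n]) auto
  moreover have "\<bar>r\<bar> < int q" using assms up by (intro least_up_bound) auto
  ultimately show ?thesis using up that(2) by blast
qed

end

section \<open>Timed correctness of programs without nested loops\<close>

fun loop_free :: "com \<Rightarrow> bool" where
  "loop_free (Seq c d) \<longleftrightarrow> loop_free c \<and> loop_free d"
| "loop_free (If b c d) \<longleftrightarrow> loop_free c \<and> loop_free d"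
| "loop_free (While b c) \<longleftrightarrow> False"
| "loop_free c \<longleftrightarrow> True"

text \<open>The meaning of programs without loops, for which no termination argument is needed. The value on
  a loop is arbitrary.\<close>

fun run :: "com \<Rightarrow> state \<Rightarrow> state" where
  "run Skip s = s"
| "run (Assign x e) s = s\<lparr>regs := (regs s)(x := aval e s)\<rparr>"
| "run (Store x i e) s = s\<lparr>arrs := (arrs s)(x := (arrs s x)(aval i s := aval e s))\<rparr>"
| "run (Seq c d) s = run d (run c s)"
| "run (If b c d) s = (if bval b s then run c s else run d s)"
| "run (While b c) s = s"

text \<open>The running time on inputs of size \<open>m\<close> is bounded by \<open>rate c * (m + 1)\<close>, provided that loops are
  not nested and make at most \<open>m + 1\<close> rounds. A loop then evaluates its condition at most
  \<open>m + 2 \<le> 2 (m + 1)\<close> times, hence the factor 2. As the rate depends on the program only, linear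
  time follows without any bookkeeping of constants.\<close>

fun rate :: "com \<Rightarrow> nat" where
  "rate Skip = 1"
| "rate (Assign x e) = acost e + 1"
| "rate (Store x i e) = acost i + acost e + 1"
| "rate (Seq c d) = rate c + rate d"
| "rate (If b c d) = bcost b + rate c + rate d + 1"
| "rate (While b c) = 2 * (bcost b + rate c + 1)"

lemma exec_loop_free: "loop_free c \<Longrightarrow> \<exists>n. exec c s n (run c s) \<and> n \<le> rate c"
proof (induction c arbitrary: s)
  case (Seq c d)
  then obtain m n where "exec c s m (run c s)" "m \<le> rate c"
    "exec d (run c s) n (run d (run c s))" "n \<le> rate d"
    by fastforce
  then have "exec (Seq c d) s (m + n) (run (Seq c d) s)" "m + n \<le> rate (Seq c d)"
    by (auto intro: exec.Seq)
  then show ?case by blast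
next
  case (If b c d)
  then obtain m n where "exec c s m (run c s)" "m \<le> rate c" "exec d s n (run d s)" "n \<le> rate d"
    by fastforce
  then have "exec (If b c d) s (bcost b + (if bval b s then m else n) + 1) (run (If b c d) s)"
    "bcost b + (if bval b s then m else n) + 1 \<le> rate (If b c d)"
    using exec.IfTrue[of b s c m "run c s" d] exec.IfFalse[of b s d n "run d s" c] by auto
  then show ?case by blast
next
  case (Assign x e)
  then show ?case using exec.Assign[of x e s] by auto
next
  case (Store x i e)
  then show ?case using exec.Store[of x i e s] by auto
qed (auto intro: exec.Skip)

definition linear_run :: "nat \<Rightarrow> com \<Rightarrow> state \<Rightarrow> (state \<Rightarrow> bool) \<Rightarrow> bool" where
  "linear_run m c s Q \<longleftrightarrow> (\<exists>n s'. exec c s n s' \<and> n \<le> rate c * (m + 1) \<and> Q s')"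

lemma linear_run_loop_free:
  assumes "loop_free c" and "Q (run c s)"
  shows "linear_run m c s Q"
proof -
  obtain n where "exec c s n (run c s)" "n \<le> rate c"
    using exec_loop_free[OF assms(1)] by blast
  moreover from this have "n \<le> rate c * (m + 1)" by simp
  ultimately show ?thesis using assms(2) unfolding linear_run_def by blast
qed

lemma linear_run_Seq:
  assumes "linear_run m c s P" and "\<And>s'. P s' \<Longrightarrow> linear_run m d s' Q"
  shows "linear_run m (Seq c d) s Q"
proof -
  obtain n1 s1 where 1: "exec c s n1 s1" "n1 \<le> rate c * (m + 1)" "P s1"
    using assms(1) unfolding linear_run_def by blast
  obtain n2 s2 where 2: "exec d s1 n2 s2" "n2 \<le> rate d * (m + 1)" "Q s2"
    using assms(2)[OF 1(3)] unfolding linear_run_def by blast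
  have "exec (Seq c d) s (n1 + n2) s2" using 1 2 by (intro exec.Seq)
  moreover have "n1 + n2 \<le> rate (Seq c d) * (m + 1)"
    using 1(2) 2(2) by (simp add: algebra_simps)
  ultimately show ?thesis using 2(3) unfolding linear_run_def by blast
qed

lemma linear_run_While:
  assumes "loop_free c" and "I 0 s"
    and step: "\<And>j s. j < N \<Longrightarrow> I j s \<Longrightarrow> bval b s \<and> I (Suc j) (run c s)"
    and exit: "\<And>s. I N s \<Longrightarrow> \<not> bval b s"
    and "N \<le> m + 1"
  shows "linear_run m (While b c) s (I N)"
proof -
  let ?r = "bcost b + rate c + 1"
  have "\<exists>n s'. exec (While b c) s n s' \<and> n \<le> ?r * (N - j + 1) \<and> I N s'"
    if "j \<le> N" "I j s" for j s
    using that
  proof (induction "N - j" arbitrary: j s)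
    case 0
    then have "j = N" by simp
    with 0 exit have "exec (While b c) s (bcost b + 1) s" by (intro exec.WhileFalse) simp
    with 0 \<open>j = N\<close> show ?case by (intro exI[of _ "bcost b + 1"] exI[of _ s]) simp
  next
    case (Suc k)
    then have "j < N" by simp
    with Suc step have "bval b s" "I (Suc j) (run c s)" by blast+
    obtain n1 where 1: "exec c s n1 (run c s)" "n1 \<le> rate c"
      using exec_loop_free[OF assms(1)] by blast
    have "k = N - Suc j" "Suc j \<le> N" using Suc by simp_all
    from Suc.hyps(1)[OF this \<open>I (Suc j) (run c s)\<close>] obtain n2 s'
      where 2: "exec (While b c) (run c s) n2 s'" "n2 \<le> ?r * (N - Suc j + 1)" "I N s'"
      by blast
    have "exec (While b c) s (bcost b + n1 + n2 + 1) s'"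
      using \<open>bval b s\<close> 1(1) 2(1) by (rule exec.WhileTrue)
    moreover have "N - j + 1 = Suc (N - Suc j + 1)" using \<open>j < N\<close> by simp
    then have "bcost b + n1 + n2 + 1 \<le> ?r * (N - j + 1)" using 1(2) 2(2) by simp
    ultimately show ?case using 2(3) by blast
  qed
  from this[of 0 s] assms(2) obtain n s'
    where *: "exec (While b c) s n s'" "n \<le> ?r * (N + 1)" "I N s'" by auto
  have "?r * (N + 1) \<le> ?r * (2 * (m + 1))" using assms(5) by (intro mult_le_mono) auto
  then have "n \<le> rate (While b c) * (m + 1)" using *(2) by (simp add: algebra_simps)
  with * show ?thesis unfolding linear_run_def by blast
qed

definition block :: "com list \<Rightarrow> com" where
  "block cs = foldr Seq cs Skip"

lemma loop_free_block [simp]: "loop_free (block cs) \<longleftrightarrow> (\<forall>c\<in>set cs. loop_free c)"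
  by (induction cs) (auto simp: block_def)

lemma run_block_Nil [simp]: "run (block []) s = s"
  and run_block_Cons [simp]: "run (block (c # cs)) s = run (block cs) (run c s)"
  by (simp_all add: block_def)

lemma run_block_append [simp]: "run (block (cs @ ds)) s = run (block ds) (run (block cs) s)"
  by (induction cs arbitrary: s) auto

section \<open>Evaluating a horocyclic word\<close>

context baumslag_solitar
begin

text \<open>Neither code is 0, the value at the bottom of the stack; so no letter is ever popped from the
  empty stack.\<close>

definition edge_code :: "bool \<Rightarrow> int" where
  "edge_code e = (if e then 1 else 2)"

lemma edge_code_eq_iff [simp]: "edge_code e = edge_code e' \<longleftrightarrow> e = e'"
  by (simp add: edge_code_def)

lemma edge_code_neq_0 [simp]: "edge_code e \<noteq> 0" "0 \<noteq> edge_code e"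
  by (simp_all add: edge_code_def)

fun stack_at :: "(int \<Rightarrow> int) \<Rightarrow> (int \<Rightarrow> int) \<Rightarrow> int \<Rightarrow> (int \<times> bool) list \<Rightarrow> bool" where
  "stack_at S E h [] \<longleftrightarrow> h = 0 \<and> E 0 = 0"
| "stack_at S E h ((r, e) # st) \<longleftrightarrow>
     0 < h \<and> S h = r \<and> E h = edge_code e \<and> stack_at S E (h - 1) st"

lemma stack_at_nonneg: "stack_at S E h st \<Longrightarrow> 0 \<le> h"
  by (cases "(S, E, h, st)" rule: stack_at.cases) auto

lemma stack_at_upd:
  "stack_at S E h st \<Longrightarrow> h < i \<Longrightarrow> stack_at (S(i := r)) (E(i := e)) h st"
proof (induction S E h st rule: stack_at.induct)
  case (2 S E h r' e' st)
  then show ?case by auto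
qed auto

definition cross_code :: "bool \<Rightarrow> com" where
  "cross_code e =
    If (And (Equal (Cell ''E'' (Reg ''h'')) (Num (edge_code (\<not> e))))
            (Equal (Rem (Reg ''k'') (Num (edge_index e))) (Num 0)))
     (block
       [Assign ''k'' (Plus (Cell ''S'' (Reg ''h''))
          (Times (Num (edge_index (\<not> e))) (Quot (Reg ''k'') (Num (edge_index e))))),
        Assign ''h'' (Minus (Reg ''h'') (Num 1))])
     (block
       [Assign ''h'' (Plus (Reg ''h'') (Num 1)),
        Store ''S'' (Reg ''h'') (Rem (Reg ''k'') (Num (edge_index e))),
        Store ''E'' (Reg ''h'') (Num (edge_code e)),
        Assign ''k'' (Times (Num (edge_index (\<not> e))) (Quot (Reg ''k'') (Num (edge_index e))))])"

definition step_code :: com where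
  "step_code = block
    [If (Equal (Cell ''in'' (Reg ''i'')) (Num 0)) (cross_code True)
      (If (Equal (Cell ''in'' (Reg ''i'')) (Num 1)) (cross_code False)
        (If (Equal (Cell ''in'' (Reg ''i'')) (Num 2))
          (Assign ''k'' (Plus (Reg ''k'') (Num 1)))
          (Assign ''k'' (Minus (Reg ''k'') (Num 1))))),
     Assign ''i'' (Plus (Reg ''i'') (Num 1))]"

definition eval_loop :: com where
  "eval_loop = While (Less (Reg ''i'') (Reg ''in'')) step_code"

definition holds_nf :: "state \<Rightarrow> normal_form \<Rightarrow> bool" where
  "holds_nf s x \<longleftrightarrow> stack_at (arrs s ''S'') (arrs s ''E'') (regs s ''h'') (fst x) \<and> regs s ''k'' = snd x"

lemma cross_code_correct:
  assumes "holds_nf s x"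
  shows "holds_nf (run (cross_code e) s) (cross e x)"
    and "y \<notin> {''h'', ''k''} \<Longrightarrow> regs (run (cross_code e) s) y = regs s y"
    and "y \<notin> {''S'', ''E''} \<Longrightarrow> arrs (run (cross_code e) s) y = arrs s y"
proof -
  obtain st k where x: "x = (st, k)" by fastforce
  have k: "regs s ''k'' = k" and st: "stack_at (arrs s ''S'') (arrs s ''E'') (regs s ''h'') st"
    using assms by (simp_all add: x holds_nf_def)
  have top: "arrs s ''E'' (regs s ''h'') = edge_code (\<not> e) \<longleftrightarrow> st \<noteq> [] \<and> snd (hd st) \<noteq> e"
    using st by (cases st) auto
  show "holds_nf (run (cross_code e) s) (cross e x)"
  proof (cases "st \<noteq> [] \<and> snd (hd st) \<noteq> e \<and> k mod edge_index e = 0")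
    case True
    then obtain r st' where "st = (r, \<not> e) # st'" by (cases st) auto
    then show ?thesis
      using st True by (simp add: holds_nf_def cross_code_def x k)
  next
    case False
    have "stack_at ((arrs s ''S'')(regs s ''h'' + 1 := k mod edge_index e))
        ((arrs s ''E'')(regs s ''h'' + 1 := edge_code e)) (regs s ''h'') st"
      using st by (rule stack_at_upd) simp
    then show ?thesis
      using False stack_at_nonneg[OF st] by (auto simp: holds_nf_def cross_code_def x k top)
  qed
qed (simp_all add: cross_code_def)

lemma loop_free_step_code: "loop_free step_code"
  by (simp add: step_code_def cross_code_def)

lemma step_code_correct:
  assumes "holds_nf s x" and "arrs s ''in'' (regs s ''i'') = int (letter_code l)"
  shows "holds_nf (run step_code s) (step l x)"
    and "regs (run step_code s) ''i'' = regs s ''i'' + 1"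
    and "regs (run step_code s) ''in'' = regs s ''in''"
    and "y \<notin> {''S'', ''E''} \<Longrightarrow> arrs (run step_code s) y = arrs s y"
proof -
  define s1 where "s1 = run (case l of Pos_t \<Rightarrow> cross_code True | Neg_t \<Rightarrow> cross_code False
    | Pos_a \<Rightarrow> Assign ''k'' (Plus (Reg ''k'') (Num 1))
    | Neg_a \<Rightarrow> Assign ''k'' (Minus (Reg ''k'') (Num 1))) s"
  have run: "run step_code s = s1\<lparr>regs := (regs s1)(''i'' := regs s1 ''i'' + 1)\<rparr>"
    using assms(2) by (cases l) (simp_all add: step_code_def s1_def)
  have nf: "holds_nf s1 (step l x)"
    using assms(1) cross_code_correct(1)[OF assms(1)]
    by (cases l; cases x) (auto simp: s1_def holds_nf_def simp del: cross.simps)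
  have "regs s1 y = regs s y" if "y \<notin> {''h'', ''k''}" for y
    using cross_code_correct(2)[OF assms(1)] that by (cases l) (auto simp: s1_def)
  moreover have "arrs s1 y = arrs s y" if "y \<notin> {''S'', ''E''}" for y
    using cross_code_correct(3)[OF assms(1)] that by (cases l) (auto simp: s1_def)
  ultimately show "holds_nf (run step_code s) (step l x)"
    "regs (run step_code s) ''i'' = regs s ''i'' + 1"
    "regs (run step_code s) ''in'' = regs s ''in''"
    "y \<notin> {''S'', ''E''} \<Longrightarrow> arrs (run step_code s) y = arrs s y"
    using nf by (simp_all add: run holds_nf_def)
qed

lemma eval_loop_correct:
  assumes "represents w n"
  shows "linear_run (length w) eval_loop (input_state w)
    (\<lambda>s. regs s ''in'' = int (length w) \<and> regs s ''k'' = n \<and>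
       (\<forall>y. y \<notin> {''in'', ''S'', ''E''} \<longrightarrow> arrs s y = (\<lambda>_. 0)))"
proof -
  define I where "I = (\<lambda>j s. regs s ''in'' = int (length w) \<and> regs s ''i'' = int j \<and>
    arrs s ''in'' = arrs (input_state w) ''in'' \<and>
    (\<forall>y. y \<notin> {''in'', ''S'', ''E''} \<longrightarrow> arrs s y = (\<lambda>_. 0)) \<and>
    holds_nf s (act (take j w) ([], 0)))"
  have "linear_run (length w) eval_loop (input_state w) (I (length w))"
    unfolding eval_loop_def
  proof (rule linear_run_While[OF loop_free_step_code])
    show "I 0 (input_state w)"
      by (simp add: I_def input_state_def holds_nf_def)
  next
    fix j s assume j: "j < length w" and I: "I j s"
    have "arrs s ''in'' (regs s ''i'') = int (letter_code (w ! j))"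
      using I j by (simp add: I_def input_state_def)
    moreover have "holds_nf s (act (take j w) ([], 0))" using I by (simp add: I_def)
    ultimately have "I (Suc j) (run step_code s)"
      using I j step_code_correct[of s "act (take j w) ([], 0)" "w ! j"]
      by (simp add: I_def take_Suc_conv_app_nth)
    then show "bval (Less (Reg ''i'') (Reg ''in'')) s \<and> I (Suc j) (run step_code s)"
      using I j by (simp add: I_def)
  qed (simp_all add: I_def)
  then show ?thesis
    using assms by (auto simp: linear_run_def I_def holds_nf_def represents_iff)
qed

end

section \<open>The table of candidate words\<close>

context baumslag_solitar
begin

text \<open>Dividing \<open>n\<close> by \<open>q\<close> with remainder and passing across \<open>t\<close> leads to the exponent
  \<open>p (n div q)\<close> one level higher. A least word may use another quotient than the rounded-down one,
  but \<open>carry_bounds\<close> shows that at level \<open>d\<close> its exponent differs from \<open>climb n d\<close> by \<open>p c\<close> with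
  \<open>0 \<le> c \<le> q\<close>.\<close>

fun climb :: "int \<Rightarrow> nat \<Rightarrow> int" where
  "climb n 0 = n"
| "climb n (Suc d) = int p * (climb n d div int q)"

text \<open>The powers of 4 are the numbers of the words \<open>t\<^sup>d\<close> (\<open>enc_replicate_Pos_t\<close>).\<close>

definition climb_loop :: com where
  "climb_loop = Seq
    (block
      [Assign ''i'' (Num 0),
       Store ''b'' (Num 0) (Reg ''k''),
       Store ''pw'' (Num 0) (Num 1)])
    (While (Less (Reg ''i'') (Reg ''in''))
      (block
        [Store ''b'' (Plus (Reg ''i'') (Num 1))
           (Times (Num (int p)) (Quot (Cell ''b'' (Reg ''i'')) (Num (int q)))),
         Store ''pw'' (Plus (Reg ''i'') (Num 1)) (Times (Num 4) (Cell ''pw'' (Reg ''i''))),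
         Assign ''i'' (Plus (Reg ''i'') (Num 1))]))"

definition climbed :: "int \<Rightarrow> nat \<Rightarrow> state \<Rightarrow> bool" where
  "climbed n m s \<longleftrightarrow> (\<forall>d\<le>m. arrs s ''b'' (int d) = climb n d \<and> arrs s ''pw'' (int d) = 4 ^ d)"

lemma climb_loop_correct:
  assumes "regs s ''in'' = int m" and "regs s ''k'' = n"
  shows "linear_run m climb_loop s
    (\<lambda>s'. climbed n m s' \<and> regs s' ''i'' = int m \<and>
       (\<forall>y. y \<notin> {''b'', ''pw''} \<longrightarrow> arrs s' y = arrs s y))"
proof -
  define I where "I = (\<lambda>(j::nat) (s'::state). climbed n j s' \<and> regs s' ''i'' = int j \<and> regs s' ''in'' = int m \<and>
    (\<forall>y. y \<notin> {''b'', ''pw''} \<longrightarrow> arrs s' y = arrs s y))"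
  have "linear_run m climb_loop s (I m)"
    unfolding climb_loop_def
  proof (rule linear_run_Seq[OF linear_run_loop_free linear_run_While[where N = m]])
    show "I 0 (run (block [Assign ''i'' (Num 0), Store ''b'' (Num 0) (Reg ''k''),
        Store ''pw'' (Num 0) (Num 1)]) s)"
      using assms by (simp add: I_def climbed_def)
  next
    fix j s' assume "j < m" "I j s'"
    then show "bval (Less (Reg ''i'') (Reg ''in'')) s' \<and>
      I (Suc j) (run (block
        [Store ''b'' (Plus (Reg ''i'') (Num 1))
           (Times (Num (int p)) (Quot (Cell ''b'' (Reg ''i'')) (Num (int q)))),
         Store ''pw'' (Plus (Reg ''i'') (Num 1)) (Times (Num 4) (Cell ''pw'' (Reg ''i''))),
         Assign ''i'' (Plus (Reg ''i'') (Num 1))]) s')"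
      by (auto simp: I_def climbed_def le_Suc_eq)
  qed (simp_all add: I_def)
  then show ?thesis by (auto simp: linear_run_def I_def)
qed

text \<open>The ways to obtain a word \<open>t\<^sup>d u\<close>, with \<open>u\<close> for the exponent \<open>b + p c\<close>, at level \<open>d\<close>: flat, or
  from a word \<open>t\<^bsup>d+1\<^esup> v\<close> of the next level by appending \<open>T a\<^sup>r\<close>. Entries contain the prefix
  \<open>t\<^sup>d\<close> because then words only grow at their right end; a common prefix does not affect
  comparisons. The number 0, which encodes no word, marks a missing entry. The bounds on the
  exponents lose no least word by \<open>least_wordE\<close>, and leave finitely many cases, all known in advance.\<close>

definition candidate :: "int \<Rightarrow> int \<Rightarrow> (nat \<Rightarrow> int) \<Rightarrow> nat \<Rightarrow> int \<Rightarrow> bool" where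
  "candidate b P G c v \<longleftrightarrow>
     (\<bar>b + int p * int c\<bar> \<le> 3 * int q \<and> v = push_digits P (apow (b + int p * int c))) \<or>
     (\<exists>c' r. c' \<le> q \<and> \<bar>r\<bar> \<le> int q \<and> b + int p * int c = int q * (b div int q + int c') + r \<and>
        G c' \<noteq> 0 \<and> v = push_digits (G c') (Neg_t # apow r))"

definition least_or_0 :: "(int \<Rightarrow> bool) \<Rightarrow> int \<Rightarrow> bool" where
  "least_or_0 A v \<longleftrightarrow> (v = 0 \<or> A v) \<and> (\<forall>u. A u \<longrightarrow> 0 < v \<and> v \<le> u)"

text \<open>Row \<open>d\<close> has an entry for each \<open>c \<le> q\<close>. Entries are honest, and at most the least word if that
  is short enough. The table ends at level \<open>m\<close>, so a least word can only be promised within a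
  budget for its length. As the inner word is two letters shorter and one level higher, the budget
  is passed on from row to row; the least word is at most as long as the input and meets it at
  level 0.\<close>

definition correct_row :: "int \<Rightarrow> nat \<Rightarrow> nat \<Rightarrow> (nat \<Rightarrow> int) \<Rightarrow> bool" where
  "correct_row n m d G \<longleftrightarrow> (\<forall>c\<le>q.
     (G c = 0 \<or> (\<exists>u. represents u (climb n d + int p * int c) \<and> G c = enc (replicate d Pos_t @ u))) \<and>
     (\<forall>u. least_word u (climb n d + int p * int c) \<longrightarrow> length u + d \<le> m \<longrightarrow>
        0 < G c \<and> G c \<le> enc (replicate d Pos_t @ u)))"

lemma enc_replicate_Pos_t: "enc (replicate d Pos_t) = 4 ^ d"
proof (induction d)
  case (Suc d)
  have "replicate (Suc d) Pos_t = replicate d Pos_t @ [Pos_t]" by (simp add: replicate_append_same)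
  with Suc show ?case by simp
qed simp

lemma push_digits_mono: "e \<le> e' \<Longrightarrow> push_digits e w \<le> push_digits e' w"
  by (simp add: push_digits_eq[of e] push_digits_eq[of e'] mult_right_mono)

lemma correct_row_nonneg: "correct_row n m d G \<Longrightarrow> c \<le> q \<Longrightarrow> 0 \<le> G c"
  unfolding correct_row_def using enc_pos by (metis less_imp_le order_refl)

text \<open>The window of carries is closed: \<open>q k = (b mod q) + p c - r\<close> lies strictly between \<open>- q\<close> and
  \<open>q (q + 1)\<close>, where \<open>p \<le> q - 1\<close> absorbs the contributions of \<open>b mod q\<close> and \<open>r\<close>.\<close>

lemma carry_bounds:
  fixes b r k :: int
  assumes "c \<le> q" and "\<bar>r\<bar> < int q" and "b + int p * int c = int q * (b div int q + k) + r"
  shows "0 \<le> k" and "k \<le> int q"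
proof -
  have q: "0 < int q" using p_less_q by simp
  have "b = int q * (b div int q) + b mod int q" by simp
  moreover have "int q * (b div int q + k) = int q * (b div int q) + int q * k"
    by (rule distrib_left)
  ultimately have eq: "int q * k = b mod int q + int p * int c - r"
    using assms(3) by linarith
  have md: "0 \<le> b mod int q" "b mod int q < int q" using q by simp_all
  have "int p * int c \<le> (int q - 1) * int q"
    using assms(1) p_less_q by (intro mult_mono) auto
  moreover have "(int q - 1) * int q = int q * int q - int q"
    and "int q * (int q + 1) = int q * int q + int q" by (simp_all add: algebra_simps)
  ultimately have "int q * k < int q * (int q + 1)" using eq md assms(2) by linarith
  moreover have "0 \<le> int p * int c" by simp
  then have "int q * (- 1) < int q * k" using eq md assms(2) by linarith
  ultimately have "k < int q + 1" "- 1 < k"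
    using q by (simp_all only: mult_less_cancel_left_pos)
  then show "0 \<le> k" "k \<le> int q" by simp_all
qed

text \<open>Honesty holds for every candidate. For the upper bound, the least word is flat or arises from a
  least word of the next level, whose entry is at most that word; appending the same letters
  preserves the comparison.\<close>

lemma correct_row_extend:
  assumes G': "correct_row n m (Suc d) G'"
    and best: "\<And>c. c \<le> q \<Longrightarrow> least_or_0 (candidate (climb n d) (4 ^ d) G' c) (G c)"
  shows "correct_row n m d G"
  unfolding correct_row_def
proof (intro allI impI conjI)
  fix c assume c: "c \<le> q"
  let ?b = "climb n d"
  have "\<exists>u. represents u (?b + int p * int c) \<and> v = enc (replicate d Pos_t @ u)"
    if "candidate ?b (4 ^ d) G' c v" for v
    using that unfolding candidate_def
  proof (elim disjE exE conjE)
    assume "v = push_digits (4 ^ d) (apow (?b + int p * int c))"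
    then have "represents (apow (?b + int p * int c)) (?b + int p * int c) \<and>
        v = enc (replicate d Pos_t @ apow (?b + int p * int c))"
      by (simp add: enc_replicate_Pos_t)
    then show ?thesis by blast
  next
    fix c' r
    assume eq: "?b + int p * int c = int q * (?b div int q + int c') + r"
      and "c' \<le> q" "G' c' \<noteq> 0" and v: "v = push_digits (G' c') (Neg_t # apow r)"
    then obtain u where u: "represents u (climb n (Suc d) + int p * int c')"
      and G'c: "G' c' = enc (replicate (Suc d) Pos_t @ u)"
      using G' unfolding correct_row_def by blast
    have "represents u (int p * (?b div int q + int c'))" using u by (simp add: algebra_simps)
    from represents_up[OF this, of r]
    have "represents (Pos_t # u @ Neg_t # apow r) (?b + int p * int c)" by (simp only: eq)
    moreover have "v = enc (replicate d Pos_t @ Pos_t # u @ Neg_t # apow r)"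
    proof -
      have "replicate (Suc d) Pos_t = replicate d Pos_t @ [Pos_t]"
        by (simp add: replicate_append_same)
      then show ?thesis unfolding v G'c by simp
    qed
    ultimately show ?thesis by blast
  qed
  then show "G c = 0 \<or> (\<exists>u. represents u (?b + int p * int c) \<and> G c = enc (replicate d Pos_t @ u))"
    using best[OF c] unfolding least_or_0_def by blast
  fix u assume u: "least_word u (?b + int p * int c)" and len: "length u + d \<le> m"
  have "\<exists>v. candidate ?b (4 ^ d) G' c v \<and> v \<le> enc (replicate d Pos_t @ u)"
    using u
  proof (cases rule: least_wordE)
    case 1
    then have "candidate ?b (4 ^ d) G' c (enc (replicate d Pos_t @ u))"
      by (simp add: candidate_def enc_replicate_Pos_t)
    then show ?thesis by blast
  next
    case (2 u' k r)
    define k' where "k' = k - ?b div int q"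
    have eq: "?b + int p * int c = int q * (?b div int q + k') + r"
      using 2(3) by (simp add: k'_def)
    note k' = carry_bounds[OF c 2(4) eq]
    define c' where "c' = nat k'"
    have c': "int c' = k'" "c' \<le> q" using k' by (simp_all add: c'_def)
    have "least_word u' (climb n (Suc d) + int p * int c')"
      using 2(2) by (simp add: c'(1) k'_def algebra_simps)
    moreover have "length u' + Suc d \<le> m" using len 2(1) by simp
    ultimately have G'c: "0 < G' c'" "G' c' \<le> enc (replicate (Suc d) Pos_t @ u')"
      using G' c'(2) unfolding correct_row_def by blast+
    have "candidate ?b (4 ^ d) G' c (push_digits (G' c') (Neg_t # apow r))"
      unfolding candidate_def using c' eq 2(4) G'c(1)
      by (intro disjI2 exI[of _ c'] exI[of _ r]) auto
    moreover have "push_digits (G' c') (Neg_t # apow r) \<le> enc (replicate d Pos_t @ u)"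
    proof -
      have "replicate (Suc d) Pos_t = replicate d Pos_t @ [Pos_t]"
        by (simp add: replicate_append_same)
      then show ?thesis
        using push_digits_mono[OF G'c(2), of "Neg_t # apow r"] unfolding 2(1) by simp
    qed
    ultimately show ?thesis by blast
  qed
  then show "0 < G c" "G c \<le> enc (replicate d Pos_t @ u)"
    using best[OF c] unfolding least_or_0_def by (blast intro: order_trans)+
qed

lemma correct_row_beyond: "correct_row n m (Suc m) (\<lambda>_. 0)"
  by (simp add: correct_row_def)

lemma correct_row_0:
  assumes "correct_row n m 0 G" and "least_word u n" and "length u \<le> m"
  shows "G 0 = enc u"
proof -
  have "0 < G 0" "G 0 \<le> enc u"
    using assms unfolding correct_row_def by (auto dest: spec[of _ 0])
  moreover from this obtain v where "represents v n" "G 0 = enc v"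
    using assms(1) unfolding correct_row_def by (auto dest: spec[of _ 0])
  ultimately show ?thesis using least_word_le[OF assms(2)] by fastforce
qed

text \<open>One array per column \<open>c\<close>, with names in unary. The level is then the only index, and the update of
  a cell visibly leaves the next level intact.\<close>

definition row_array :: "nat \<Rightarrow> string" where
  "row_array c = CHR ''g'' # replicate c CHR ''g''"

lemma row_array_eq_iff [simp]: "row_array c = row_array c' \<longleftrightarrow> c = c'"
  by (auto simp: row_array_def replicate_eq_replicate)

lemma row_array_neq [simp]:
  "hd x \<noteq> CHR ''g'' \<Longrightarrow> row_array c \<noteq> x" "hd x \<noteq> CHR ''g'' \<Longrightarrow> x \<noteq> row_array c"
  by (auto simp: row_array_def)

definition set_reg :: "string \<Rightarrow> int \<Rightarrow> state \<Rightarrow> state" where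
  "set_reg x v s = s\<lparr>regs := (regs s)(x := v)\<rparr>"

lemma regs_set_reg [simp]: "regs (set_reg x v s) = (regs s)(x := v)"
  and arrs_set_reg [simp]: "arrs (set_reg x v s) = arrs s"
  and set_reg_set_reg [simp]: "set_reg x v (set_reg x u s) = set_reg x v s"
  and set_reg_same: "set_reg x (regs s x) s = s"
  and run_Assign: "run (Assign x e) s = set_reg x (aval e s) s"
  by (simp_all add: set_reg_def)

text \<open>The register holds the minimum of the values offered so far, or 0 if there was none.\<close>

definition relax :: "bexp \<times> aexp \<Rightarrow> com" where
  "relax = (\<lambda>(b, e). If (And b (Not (And (Not (Equal (Reg ''m'') (Num 0))) (Not (Less e (Reg ''m''))))))
     (Assign ''m'' e) Skip)"

text \<open>The conditions and values must not refer to the register that collects the minimum. Then they can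
  all be evaluated in the initial state.\<close>

lemma run_relax_block:
  assumes "\<And>b e v. (b, e) \<in> set cs \<Longrightarrow> bval b (set_reg ''m'' v s) = bval b s"
    and "\<And>b e v. (b, e) \<in> set cs \<Longrightarrow> aval e (set_reg ''m'' v s) = aval e s"
    and "\<And>b e. (b, e) \<in> set cs \<Longrightarrow> bval b s \<Longrightarrow> 0 < aval e s"
    and "least_or_0 A (regs s ''m'')"
  shows "\<exists>v. run (block (map relax cs)) s = set_reg ''m'' v s \<and>
    least_or_0 (\<lambda>u. A u \<or> (\<exists>(b, e)\<in>set cs. bval b s \<and> u = aval e s)) v"
  using assms
proof (induction cs arbitrary: s A)
  case Nil
  then show ?case by (intro exI[of _ "regs s ''m''"]) (simp only: set_reg_same, simp)
next
  case (Cons x cs)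
  obtain b e where x: "x = (b, e)" by fastforce
  define v where "v = (if bval b s \<and> (regs s ''m'' = 0 \<or> aval e s < regs s ''m'') then aval e s
    else regs s ''m'')"
  have run: "run (relax x) s = set_reg ''m'' v s"
    by (auto simp: relax_def x v_def run_Assign set_reg_same simp del: run.simps(2))
  have "bval b s \<Longrightarrow> 0 < aval e s" using Cons.prems(3)[of b e] x by simp
  then have "least_or_0 (\<lambda>u. A u \<or> bval b s \<and> u = aval e s) v"
    using Cons.prems(4) by (auto simp: least_or_0_def v_def) 
  moreover have frame: "bval b' (set_reg ''m'' v s) = bval b' s" "aval e' (set_reg ''m'' v s) = aval e' s"
    if "(b', e') \<in> set cs" for b' e' v
    by (rule Cons.prems(1)[of b' e' v] Cons.prems(2)[of b' e' v], insert that, simp)+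
  moreover have "0 < aval e' s" if "(b', e') \<in> set cs" "bval b' s" for b' e'
    using Cons.prems(3)[of b' e'] that by simp
  ultimately have "\<exists>v'. run (block (map relax cs)) (set_reg ''m'' v s) = set_reg ''m'' v' (set_reg ''m'' v s) \<and>
    least_or_0 (\<lambda>u. (A u \<or> bval b s \<and> u = aval e s) \<or>
      (\<exists>(b', e')\<in>set cs. bval b' (set_reg ''m'' v s) \<and> u = aval e' (set_reg ''m'' v s))) v'"
    by (intro Cons.IH) auto
  moreover have "(\<exists>(b', e')\<in>set cs. bval b' (set_reg ''m'' v s) \<and> u = aval e' (set_reg ''m'' v s)) \<longleftrightarrow>
      (\<exists>(b', e')\<in>set cs. bval b' s \<and> u = aval e' s)" for u
    using frame by (intro bex_cong refl) auto
  ultimately show ?case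
    using run by (simp add: x disj_assoc)
qed

definition flat_choice :: "nat \<Rightarrow> int \<Rightarrow> bexp \<times> aexp" where
  "flat_choice c x =
    (Equal (Plus (Cell ''b'' (Reg ''i'')) (Num (int p * int c))) (Num x),
     Plus (Times (Cell ''pw'' (Reg ''i'')) (Num (4 ^ length (apow x)))) (Num (push_digits 0 (apow x))))"

definition up_choice :: "nat \<Rightarrow> nat \<Rightarrow> int \<Rightarrow> bexp \<times> aexp" where
  "up_choice c c' r =
    (And
      (Equal (Plus (Cell ''b'' (Reg ''i'')) (Num (int p * int c)))
        (Plus (Times (Num (int q)) (Plus (Quot (Cell ''b'' (Reg ''i'')) (Num (int q))) (Num (int c'))))
          (Num r)))
      (Not (Equal (Cell (row_array c') (Plus (Reg ''i'') (Num 1))) (Num 0))),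
     Plus (Times (Cell (row_array c') (Plus (Reg ''i'') (Num 1)))
         (Num (4 ^ length (Neg_t # apow r))))
       (Num (push_digits 0 (Neg_t # apow r))))"

text \<open>The exponents \<open>x\<close> and \<open>r\<close> and the carry \<open>c'\<close> range over sets that depend on \<open>p\<close> and \<open>q\<close> only. They
  are enumerated when the program is built; the factors \<open>4\<^bsup>|x|\<^esup>\<close> and \<open>4\<^bsup>1+|r|\<^esup>\<close> thereby become
  constants, and a row is computed without a loop.\<close>

definition choices :: "nat \<Rightarrow> (bexp \<times> aexp) list" where
  "choices c = map (flat_choice c) [- 3 * int q..3 * int q] @
     concat (map (\<lambda>c'. map (up_choice c c') [- int q..int q]) [0..<Suc q])"

definition cell_code :: "nat \<Rightarrow> com" where
  "cell_code c = block
    [Assign ''m'' (Num 0),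
     block (map relax (choices c)),
     Store (row_array c) (Reg ''i'') (Reg ''m'')]"

lemma set_choices: "set (choices c) =
    flat_choice c ` {- 3 * int q..3 * int q} \<union>
    (\<Union>c'\<in>{..q}. up_choice c c' ` {- int q..int q})"
  by (simp add: choices_def atLeast0LessThan lessThan_Suc_atMost del: upt_Suc)

lemma choices_eq_candidate:
  "(\<exists>(b, e)\<in>set (choices c). bval b s \<and> v = aval e s) \<longleftrightarrow>
     candidate (arrs s ''b'' (regs s ''i'')) (arrs s ''pw'' (regs s ''i''))
       (\<lambda>c'. arrs s (row_array c') (regs s ''i'' + 1)) c v"
proof -
  have flat: "bval (fst (flat_choice c x)) s \<longleftrightarrow> arrs s ''b'' (regs s ''i'') + int p * int c = x"
    "aval (snd (flat_choice c x)) s = push_digits (arrs s ''pw'' (regs s ''i'')) (apow x)" for x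
    by (simp_all add: flat_choice_def push_digits_eq[of "arrs s ''pw'' (regs s ''i'')"])
  have up: "bval (fst (up_choice c c' r)) s \<longleftrightarrow>
      arrs s ''b'' (regs s ''i'') + int p * int c = int q * (arrs s ''b'' (regs s ''i'') div int q + int c') + r
      \<and> arrs s (row_array c') (regs s ''i'' + 1) \<noteq> 0"
    "aval (snd (up_choice c c' r)) s =
      push_digits (arrs s (row_array c') (regs s ''i'' + 1)) (Neg_t # apow r)" for c' r
    by (simp_all only: up_choice_def push_digits_eq[of "arrs s (row_array c') (regs s ''i'' + 1)"]
        fst_conv snd_conv bval.simps aval.simps)
  have flat_range: "(\<exists>x\<in>{- 3 * int q..3 * int q}. y = x \<and> v = f x) \<longleftrightarrow> \<bar>y\<bar> \<le> 3 * int q \<and> v = f y"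
    for y f by auto
  have up_range: "(\<exists>c'\<in>{..q}. \<exists>r\<in>{- int q..int q}. (E c' r \<and> N c') \<and> V c' r) \<longleftrightarrow>
      (\<exists>c' r. c' \<le> q \<and> \<bar>r\<bar> \<le> int q \<and> E c' r \<and> N c' \<and> V c' r)" for E N V
    unfolding Bex_def atMost_iff atLeastAtMost_iff abs_le_iff minus_le_iff[of _ "int q"] by blast
  show ?thesis
    unfolding set_choices candidate_def bex_Un bex_UN bex_simps case_prod_beta flat up flat_range
      up_range ..
qed

lemma run_cell_code:
  assumes "0 < arrs s ''pw'' (regs s ''i'')"
    and "\<And>c'. c' \<le> q \<Longrightarrow> 0 \<le> arrs s (row_array c') (regs s ''i'' + 1)"
  shows "\<exists>v. run (cell_code c) s =
      (set_reg ''m'' v s)\<lparr>arrs := (arrs s)(row_array c := (arrs s (row_array c))(regs s ''i'' := v))\<rparr> \<and>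
    least_or_0 (candidate (arrs s ''b'' (regs s ''i'')) (arrs s ''pw'' (regs s ''i''))
       (\<lambda>c'. arrs s (row_array c') (regs s ''i'' + 1)) c) v"
proof -
  let ?s = "set_reg ''m'' 0 s"
  have frame: "bval (fst x) (set_reg ''m'' v s) = bval (fst x) s \<and>
      aval (snd x) (set_reg ''m'' v s) = aval (snd x) s" if "x \<in> set (choices c)" for x v s
    using that by (auto simp: set_choices flat_choice_def up_choice_def)
  have pos: "0 < aval e ?s" if "(b, e) \<in> set (choices c)" "bval b ?s" for b e
  proof -
    have "candidate (arrs ?s ''b'' (regs ?s ''i'')) (arrs ?s ''pw'' (regs ?s ''i''))
       (\<lambda>c'. arrs ?s (row_array c') (regs ?s ''i'' + 1)) c (aval e ?s)"
      using that unfolding choices_eq_candidate[symmetric] by blast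
    moreover have "0 < push_digits a w" if "0 < a" for a w
      using that push_digits_0_bounds[of w] push_digits_eq[of a w] by (simp add: add_pos_nonneg)
    ultimately show ?thesis
      using assms unfolding candidate_def by (fastforce simp del: push_digits_Cons simp: order_le_less)
  qed
  have "\<exists>v. run (block (map relax (choices c))) ?s = set_reg ''m'' v ?s \<and>
    least_or_0 (\<lambda>u. False \<or> (\<exists>(b, e)\<in>set (choices c). bval b ?s \<and> u = aval e ?s)) v"
  proof (rule run_relax_block)
    show "bval b (set_reg ''m'' v ?s) = bval b ?s" if "(b, e) \<in> set (choices c)" for b e v
      using frame[OF that] by simp
    show "aval e (set_reg ''m'' v ?s) = aval e ?s" if "(b, e) \<in> set (choices c)" for b e v
      using frame[OF that] by simp
  qed (use pos in \<open>auto simp: least_or_0_def\<close>)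
  then obtain v where v: "run (block (map relax (choices c))) ?s = set_reg ''m'' v ?s"
    and least: "least_or_0 (\<lambda>u. \<exists>(b, e)\<in>set (choices c). bval b ?s \<and> u = aval e ?s) v"
    by auto
  have "run (cell_code c) s =
      (set_reg ''m'' v s)\<lparr>arrs := (arrs s)(row_array c := (arrs s (row_array c))(regs s ''i'' := v))\<rparr>"
    using v by (simp add: cell_code_def run_Assign del: run.simps(2))
  with least show ?thesis unfolding choices_eq_candidate by auto
qed

definition row_code :: com where
  "row_code = block (map cell_code [0..<Suc q] @ [Assign ''i'' (Minus (Reg ''i'') (Num 1))])"

text \<open>Cells of row \<open>d\<close> depend on the row above only, so the cells already computed do not influence the
  next one.\<close>

lemma run_row_cells:
  assumes i: "regs s ''i'' = int d" and s: "arrs s ''b'' (int d) = climb n d" "arrs s ''pw'' (int d) = 4 ^ d"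
    and G': "correct_row n m (Suc d) (\<lambda>c. arrs s (row_array c) (int (Suc d)))"
    and "k \<le> Suc q"
  shows "\<exists>G v. run (block (map cell_code [0..<k])) s =
      (set_reg ''m'' v s)\<lparr>arrs := (\<lambda>y. if \<exists>c<k. y = row_array c
         then (arrs s y)(int d := G y) else arrs s y)\<rparr> \<and>
    (\<forall>c<k. least_or_0 (candidate (climb n d) (4 ^ d)
       (\<lambda>c'. arrs s (row_array c') (int (Suc d))) c) (G (row_array c)))"
  using assms(5)
proof (induction k)
  case 0
  show ?case by (intro exI[of _ "\<lambda>_. 0"] exI[of _ "regs s ''m''"]) (simp add: set_reg_same)
next
  case (Suc k)
  then obtain G v where 1: "run (block (map cell_code [0..<k])) s =
      (set_reg ''m'' v s)\<lparr>arrs := (\<lambda>y. if \<exists>c<k. y = row_array c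
         then (arrs s y)(int d := G y) else arrs s y)\<rparr>" (is "_ = ?s1")
    and G: "\<forall>c<k. least_or_0 (candidate (climb n d) (4 ^ d)
       (\<lambda>c'. arrs s (row_array c') (int (Suc d))) c) (G (row_array c))"
    by auto
  have same: "arrs ?s1 ''b'' (regs ?s1 ''i'') = climb n d" "arrs ?s1 ''pw'' (regs ?s1 ''i'') = 4 ^ d"
    "arrs ?s1 (row_array c') (regs ?s1 ''i'' + 1) = arrs s (row_array c') (int (Suc d))" for c'
    using i s by (auto simp: add.commute)
  have nonneg: "0 \<le> arrs s (row_array c') (int (Suc d))" if "c' \<le> q" for c'
    using correct_row_nonneg[OF G' that] .
  obtain v' where 2: "run (cell_code k) ?s1 =
      (set_reg ''m'' v' ?s1)\<lparr>arrs := (arrs ?s1)(row_array k := (arrs ?s1 (row_array k))(regs ?s1 ''i'' := v'))\<rparr>"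
    and v': "least_or_0 (candidate (climb n d) (4 ^ d)
       (\<lambda>c'. arrs s (row_array c') (int (Suc d))) k) v'"
    using run_cell_code[of ?s1 k, unfolded same] nonneg by auto
  have "run (block (map cell_code [0..<Suc k])) s = run (cell_code k) ?s1"
    by (simp only: upt_Suc_append[OF le0] map_append run_block_append list.map run_block_Cons
        run_block_Nil 1)
  also have "\<dots> = (set_reg ''m'' v' s)\<lparr>arrs := (\<lambda>y. if \<exists>c<Suc k. y = row_array c
         then (arrs s y)(int d := (G(row_array k := v')) y) else arrs s y)\<rparr>"
  proof -
    have upd: "(\<lambda>y. if \<exists>c<k. y = row_array c then (arrs s y)(int d := G y) else arrs s y)
        (row_array k := (arrs s (row_array k))(int d := v')) =
      (\<lambda>y. if \<exists>c<Suc k. y = row_array c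
         then (arrs s y)(int d := (G(row_array k := v')) y) else arrs s y)"
      by (auto simp: fun_eq_iff less_Suc_eq)
    show ?thesis unfolding 2 upd[symmetric] using i by (simp add: set_reg_def)
  qed
  finally show ?case
    using G v' by (intro exI[of _ "G(row_array k := v')"] exI[of _ v']) (auto simp: less_Suc_eq)
qed

lemma row_code_correct:
  assumes "regs s ''i'' = int d" and "d \<le> m" and "climbed n m s"
    and "correct_row n m (Suc d) (\<lambda>c. arrs s (row_array c) (int (Suc d)))"
  shows "regs (run row_code s) ''i'' = int d - 1" and "climbed n m (run row_code s)"
    and "correct_row n m d (\<lambda>c. arrs (run row_code s) (row_array c) (int d))"
proof -
  have "arrs s ''b'' (int d) = climb n d" "arrs s ''pw'' (int d) = 4 ^ d"
    using assms(2,3) by (simp_all add: climbed_def)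
  from run_row_cells[OF assms(1) this assms(4) order_refl] obtain G v where
    run: "run (block (map cell_code [0..<Suc q])) s =
      (set_reg ''m'' v s)\<lparr>arrs := (\<lambda>y. if \<exists>c<Suc q. y = row_array c
         then (arrs s y)(int d := G y) else arrs s y)\<rparr>"
    and G: "\<forall>c<Suc q. least_or_0 (candidate (climb n d) (4 ^ d)
       (\<lambda>c'. arrs s (row_array c') (int (Suc d))) c) (G (row_array c))"
    by auto
  have row: "correct_row n m d (\<lambda>c. G (row_array c))"
    using correct_row_extend[OF assms(4)] G by (simp add: less_Suc_eq_le)
  show "regs (run row_code s) ''i'' = int d - 1"
    unfolding row_code_def run_block_append run using assms(1) by simp
  show "climbed n m (run row_code s)"
    unfolding row_code_def run_block_append run using assms(3) by (simp add: climbed_def)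
  show "correct_row n m d (\<lambda>c. arrs (run row_code s) (row_array c) (int d))"
    unfolding row_code_def run_block_append run using row
    by (simp add: correct_row_def less_Suc_eq_le)
qed

lemma loop_free_row_code: "loop_free row_code"
  by (auto simp: row_code_def cell_code_def relax_def)

text \<open>Rows are computed from the highest level down to 0. The row above the highest level consists of
  untouched memory, and its zeros are the missing entries of \<open>correct_row_beyond\<close>.\<close>

definition table_loop :: com where
  "table_loop = While (Not (Less (Reg ''i'') (Num 0))) row_code"

lemma table_loop_correct:
  assumes "regs s ''i'' = int m" and "climbed n m s"
    and "\<And>c. arrs s (row_array c) = (\<lambda>_. 0)"
  shows "linear_run m table_loop s (\<lambda>s'. correct_row n m 0 (\<lambda>c. arrs s' (row_array c) 0))"
proof -
  define I where "I = (\<lambda>(j::nat) (s::state). regs s ''i'' = int m - int j \<and> climbed n m s \<and>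
    correct_row n m (Suc m - j) (\<lambda>c. arrs s (row_array c) (int (Suc m - j))))"
  have "linear_run m table_loop s (I (Suc m))"
    unfolding table_loop_def
  proof (rule linear_run_While[OF loop_free_row_code])
    show "I 0 s" using assms correct_row_beyond by (simp add: I_def)
  next
    fix j s assume j: "j < Suc m" and I: "I j s"
    then have d: "Suc m - j = Suc (m - j)" "regs s ''i'' = int (m - j)" "m - j \<le> m"
      by (auto simp: I_def)
    then show "bval (Not (Less (Reg ''i'') (Num 0))) s \<and> I (Suc j) (run row_code s)"
      using row_code_correct[OF d(2,3), of n] I by (simp add: I_def of_nat_diff)
  qed (simp_all add: I_def)
  then show ?thesis by (auto simp: linear_run_def I_def)
qed

section \<open>Reading off the word\<close>

text \<open>Division by 4 yields the letters from the last to the first. Their number is determined in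
  advance, since the output array starts with the first letter.\<close>

definition length_loop :: com where
  "length_loop = Seq
    (block [Assign ''y'' (Cell (row_array 0) (Num 0)), Assign ''l'' (Num 0)])
    (While (Less (Num 1) (Reg ''y''))
      (block [Assign ''y'' (Quot (Reg ''y'') (Num 4)), Assign ''l'' (Plus (Reg ''l'') (Num 1))]))"

definition letters_loop :: com where
  "letters_loop = Seq
    (block [Assign ''y'' (Cell (row_array 0) (Num 0)), Assign ''out'' (Reg ''l'')])
    (While (Less (Num 0) (Reg ''l''))
      (block
        [Assign ''l'' (Minus (Reg ''l'') (Num 1)),
         Store ''out'' (Reg ''l'') (Rem (Reg ''y'') (Num 4)),
         Assign ''y'' (Quot (Reg ''y'') (Num 4))]))"

lemma enc_take_Suc:
  assumes "j < length u"
  shows "enc (take (Suc j) u) div 4 = enc (take j u)"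
    and "enc (take (Suc j) u) mod 4 = int (letter_code (u ! j))"
  using letter_code_less[of "u ! j"] by (simp_all add: take_Suc_conv_app_nth[OF assms])

lemma length_loop_correct:
  assumes "arrs s (row_array 0) 0 = enc u" and "length u \<le> m"
  shows "linear_run m length_loop s (\<lambda>s'. regs s' ''l'' = int (length u) \<and> arrs s' = arrs s)"
proof -
  define I where "I = (\<lambda>(j::nat) (s'::state). regs s' ''y'' = enc (take (length u - j) u) \<and>
    regs s' ''l'' = int j \<and> arrs s' = arrs s)"
  have "linear_run m length_loop s (I (length u))"
    unfolding length_loop_def
  proof (rule linear_run_Seq[OF linear_run_loop_free linear_run_While[where N = "length u"]])
    show "I 0 (run (block [Assign ''y'' (Cell (row_array 0) (Num 0)), Assign ''l'' (Num 0)]) s)"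
      using assms by (simp add: I_def)
  next
    fix j s' assume j: "j < length u" and I: "I j s'"
    have d: "length u - j = Suc (length u - Suc j)" using j by simp
    have "1 < enc (take (length u - j) u)"
      using enc_less_length[of "[]" "take (length u - j) u"] j by simp
    then show "bval (Less (Num 1) (Reg ''y'')) s' \<and>
      I (Suc j) (run (block [Assign ''y'' (Quot (Reg ''y'') (Num 4)),
        Assign ''l'' (Plus (Reg ''l'') (Num 1))]) s')"
      using I j enc_take_Suc(1)[of "length u - Suc j" u] by (simp add: I_def d)
  qed (use assms(2) in \<open>simp_all add: I_def\<close>)
  then show ?thesis by (auto simp: linear_run_def I_def)
qed

lemma letters_loop_correct:
  assumes "arrs s (row_array 0) 0 = enc u" and "length u \<le> m" and "regs s ''l'' = int (length u)"
  shows "linear_run m letters_loop s (\<lambda>s'. outputs s' u)"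
proof -
  define I where "I = (\<lambda>(j::nat) (s'::state). regs s' ''y'' = enc (take (length u - j) u) \<and>
    regs s' ''l'' = int (length u - j) \<and> regs s' ''out'' = int (length u) \<and>
    (\<forall>k. length u - j \<le> k \<and> k < length u \<longrightarrow> arrs s' ''out'' (int k) = int (letter_code (u ! k))))"
  have "linear_run m letters_loop s (I (length u))"
    unfolding letters_loop_def
  proof (rule linear_run_Seq[OF linear_run_loop_free linear_run_While[where N = "length u"]])
    show "I 0 (run (block [Assign ''y'' (Cell (row_array 0) (Num 0)), Assign ''out'' (Reg ''l'')]) s)"
      using assms by (simp add: I_def)
  next
    fix j s' assume j: "j < length u" and I: "I j s'"
    define d where "d = length u - Suc j"
    have d: "length u - j = Suc d" "length u - Suc j = d" "d < length u" using j by (simp_all add: d_def)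
    show "bval (Less (Num 0) (Reg ''l'')) s' \<and>
      I (Suc j) (run (block
        [Assign ''l'' (Minus (Reg ''l'') (Num 1)),
         Store ''out'' (Reg ''l'') (Rem (Reg ''y'') (Num 4)),
         Assign ''y'' (Quot (Reg ''y'') (Num 4))]) s')"
      using I enc_take_Suc[OF d(3)] unfolding I_def d(1,2) by (auto simp: Suc_le_eq)
  qed (use assms(2) in \<open>simp_all add: I_def\<close>)
  then show ?thesis by (auto simp: linear_run_def I_def outputs_def)
qed

definition normal_form_program :: com where
  "normal_form_program =
    Seq eval_loop (Seq climb_loop (Seq table_loop (Seq length_loop letters_loop)))"

lemma normal_form_program_correct:
  assumes "horocyclic p q w"
  shows "linear_run (length w) normal_form_program (input_state w) (\<lambda>s. outputs s (llnf p q w))"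
proof -
  obtain n where w: "represents w n" using assms by (rule horocyclic_imp_represents)
  then obtain u where u: "least_word u n" by (rule least_word_exists)
  have len: "length u \<le> length w" using u w by (rule least_word_length_le)
  have "linear_run (length w) normal_form_program (input_state w) (\<lambda>s. outputs s u)"
    unfolding normal_form_program_def
  proof (rule linear_run_Seq[OF eval_loop_correct[OF w]], elim conjE)
    fix s :: state assume s: "regs s ''in'' = int (length w)" "regs s ''k'' = n"
      "\<forall>y. y \<notin> {''in'', ''S'', ''E''} \<longrightarrow> arrs s y = (\<lambda>_. 0)"
    show "linear_run (length w) (Seq climb_loop (Seq table_loop (Seq length_loop letters_loop))) s
      (\<lambda>s. outputs s u)"
    proof (rule linear_run_Seq[OF climb_loop_correct[OF s(1,2)]], elim conjE)
      fix s' :: state assume s': "climbed n (length w) s'" "regs s' ''i'' = int (length w)"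
        "\<forall>y. y \<notin> {''b'', ''pw''} \<longrightarrow> arrs s' y = arrs s y"
      have rows: "arrs s' (row_array c) = (\<lambda>_. 0)" for c
        using s(3) s'(3) by simp
      show "linear_run (length w) (Seq table_loop (Seq length_loop letters_loop)) s' (\<lambda>s. outputs s u)"
      proof (rule linear_run_Seq[OF table_loop_correct[OF s'(2,1) rows]])
        fix s :: state assume "correct_row n (length w) 0 (\<lambda>c. arrs s (row_array c) 0)"
        then have y: "arrs s (row_array 0) 0 = enc u" using u len by (rule correct_row_0)
        show "linear_run (length w) (Seq length_loop letters_loop) s (\<lambda>s. outputs s u)"
          by (rule linear_run_Seq[OF length_loop_correct[OF y len]])
            (use letters_loop_correct[OF _ len] y in auto)
      qed
    qed
  qed
  moreover have "llnf p q w = u" using w u by (rule llnf_unique_least)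
  ultimately show ?thesis by simp
qed

end

theorem corollary4p5:
  fixes p q :: nat
  assumes "1 \<le> p" and "p < q"
  shows "linear_time_computable_on {w. horocyclic p q w} (llnf p q)"
proof -
  interpret baumslag_solitar p q using assms by unfold_locales
  show ?thesis
    unfolding linear_time_computable_on_def
    using normal_form_program_correct unfolding linear_run_def by blast
qed

end
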